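(* Let $\mathbb{F}_2$ denote the free group on two generators. Then for every $1\le p<\infty$, $$\alpha^\#_p(\mathbb{F}_2)=\max\left\{\frac12,\frac1p\right\}.$$
   Context: For a finitely generated group $G$, $d_G$ is the left-invariant word metric induced by a finite symmetric generating set, and $L_p=L_p([0,1])$. Let $\mathrm{Isom}(L_p)$ be the group of linear isometric automorphisms of $L_p$. Given a homomorphism $\pi:G\to \mathrm{Isom}(L_p)$, a $1$-cocycle with respect to $\pi$ is a map $f:G\to L_p$ with $f(xy)=\pi(x)f(y)+f(x)$ for all $x,y\in G$. A map $\psi:G\to L_p$ is equivariant if $\psi(x)=\pi(x)v+f(x)$ for some homomorphism $\pi:G\to\mathrm{Isom}(L_p)$, some $1$-cocycle $f$ with respect to $\pi$ and some $v\in L_p$ (i.e. $\psi$ is an orbit map of an affine isometric action). $\alpha^\#_p(G)$ is the supremum of all $\alpha\ge 0$ for which there exist a Lipschitz equivariant map $f:G\to L_p$ and $c>0$ such that $\|f(x)-f(y)\|_p\ge c\, d_G(x,y)^\alpha$ for all distinct $x,y\in G$. It does not depend on the generating set. *)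

theory Defs
  imports "HOL-Analysis.Analysis" "HOL-Algebra.Algebra"
begin

section \<open>The spaces $L_p([0,1])$\<close>

text \<open>The type \<open>L0\<close> consists of the real measurable functions on the unit interval modulo equality
  almost everywhere. Each $L_p$ is a linear subspace of it, so the exponent stays a term.\<close>

abbreviation unit_leb :: "real measure" where
  "unit_leb \<equiv> lebesgue_on {0..1}"

definition ae_eq :: "(real \<Rightarrow> real) \<Rightarrow> (real \<Rightarrow> real) \<Rightarrow> bool" where
  "ae_eq f g \<longleftrightarrow> f \<in> borel_measurable unit_leb \<and> g \<in> borel_measurable unit_leb \<and>
     (AE t in unit_leb. f t = g t)"

lemma part_equivp_ae_eq: "part_equivp ae_eq"
proof (rule part_equivpI)
  have "ae_eq (\<lambda>_. 0) (\<lambda>_. 0)"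
    by (simp add: ae_eq_def)
  then show "\<exists>f. ae_eq f f" by blast
  show "symp ae_eq"
    by (auto simp: symp_def ae_eq_def elim: eventually_mono)
  show "transp ae_eq"
    unfolding transp_def ae_eq_def
  proof (intro allI impI, elim conjE, intro conjI)
    fix f g h :: "real \<Rightarrow> real"
    assume "AE t in unit_leb. f t = g t" "AE t in unit_leb. g t = h t"
    then show "AE t in unit_leb. f t = h t" by eventually_elim simp
  qed
qed

quotient_type L0 = "real \<Rightarrow> real" / partial: ae_eq
  by (rule part_equivp_ae_eq)

instantiation L0 :: real_vector
begin

lift_definition zero_L0 :: L0 is "\<lambda>_. 0"
  by (simp add: ae_eq_def)

lift_definition plus_L0 :: "L0 \<Rightarrow> L0 \<Rightarrow> L0" is "\<lambda>f g t. f t + g t"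
  unfolding ae_eq_def by (auto elim: eventually_elim2)

lift_definition uminus_L0 :: "L0 \<Rightarrow> L0" is "\<lambda>f t. - f t"
  unfolding ae_eq_def by (auto elim: eventually_mono)

lift_definition minus_L0 :: "L0 \<Rightarrow> L0 \<Rightarrow> L0" is "\<lambda>f g t. f t - g t"
  unfolding ae_eq_def by (auto elim: eventually_elim2)

lift_definition scaleR_L0 :: "real \<Rightarrow> L0 \<Rightarrow> L0" is "\<lambda>c f t. c * f t"
  unfolding ae_eq_def by (auto elim: eventually_mono)

instance
  by standard (transfer; simp add: ae_eq_def algebra_simps)+

end

lift_definition p_integrable :: "real \<Rightarrow> L0 \<Rightarrow> bool" is
  "\<lambda>p f. integrable unit_leb (\<lambda>t. \<bar>f t\<bar> powr p)"
proof -
  fix p and f g :: "real \<Rightarrow> real"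
  assume "ae_eq f g"
  then have m: "f \<in> borel_measurable unit_leb" "g \<in> borel_measurable unit_leb"
    and ae: "AE t in unit_leb. f t = g t" by (auto simp: ae_eq_def)
  show "integrable unit_leb (\<lambda>t. \<bar>f t\<bar> powr p) = integrable unit_leb (\<lambda>t. \<bar>g t\<bar> powr p)"
    by (rule integrable_cong_AE) (use m ae in \<open>auto elim: eventually_mono\<close>)
qed

definition Lp :: "real \<Rightarrow> L0 set" where
  "Lp p = {u. p_integrable p u}"

lift_definition Lp_norm :: "real \<Rightarrow> L0 \<Rightarrow> real" is
  "\<lambda>p f. (\<integral>t. \<bar>f t\<bar> powr p \<partial>unit_leb) powr (1 / p)"
proof -
  fix p and f g :: "real \<Rightarrow> real"
  assume "ae_eq f g"
  then have m: "f \<in> borel_measurable unit_leb" "g \<in> borel_measurable unit_leb"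
    and ae: "AE t in unit_leb. f t = g t" by (auto simp: ae_eq_def)
  have "(\<integral>t. \<bar>f t\<bar> powr p \<partial>unit_leb) = (\<integral>t. \<bar>g t\<bar> powr p \<partial>unit_leb)"
    by (rule integral_cong_AE) (use m ae in \<open>auto elim: eventually_mono\<close>)
  then show "(\<integral>t. \<bar>f t\<bar> powr p \<partial>unit_leb) powr (1 / p) = (\<integral>t. \<bar>g t\<bar> powr p \<partial>unit_leb) powr (1 / p)"
    by simp
qed

section \<open>Affine isometric actions on $L_p$\<close>

definition Isom_Lp :: "real \<Rightarrow> (L0 \<Rightarrow> L0) monoid" where
  "Isom_Lp p = BijGroup (Lp p)
     \<lparr>carrier := {T \<in> Bij (Lp p).
        (\<forall>u\<in>Lp p. \<forall>v\<in>Lp p. T (u + v) = T u + T v) \<and>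
        (\<forall>c. \<forall>u\<in>Lp p. T (c *\<^sub>R u) = c *\<^sub>R T u) \<and>
        (\<forall>u\<in>Lp p. Lp_norm p (T u) = Lp_norm p u)}\<rparr>"

definition is_cocycle :: "real \<Rightarrow> ('a, 'b) monoid_scheme \<Rightarrow> ('a \<Rightarrow> L0 \<Rightarrow> L0) \<Rightarrow> ('a \<Rightarrow> L0) \<Rightarrow> bool" where
  "is_cocycle p G \<pi> f \<longleftrightarrow> f \<in> carrier G \<rightarrow> Lp p \<and>
     (\<forall>x\<in>carrier G. \<forall>y\<in>carrier G. f (x \<otimes>\<^bsub>G\<^esub> y) = \<pi> x (f y) + f x)"

definition equivariant_Lp :: "real \<Rightarrow> ('a, 'b) monoid_scheme \<Rightarrow> ('a \<Rightarrow> L0) \<Rightarrow> bool" where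
  "equivariant_Lp p G \<psi> \<longleftrightarrow>
     (\<exists>\<pi>\<in>hom G (Isom_Lp p). \<exists>f. is_cocycle p G \<pi> f \<and>
        (\<exists>v\<in>Lp p. \<forall>x\<in>carrier G. \<psi> x = \<pi> x v + f x))"


section \<open>Word metrics and equivariant compression\<close>

definition finite_symmetric_generating :: "('a, 'b) monoid_scheme \<Rightarrow> 'a set \<Rightarrow> bool" where
  "finite_symmetric_generating G S \<longleftrightarrow> finite S \<and> S \<subseteq> carrier G \<and>
     (\<forall>s\<in>S. inv\<^bsub>G\<^esub> s \<in> S) \<and> generate G S = carrier G"

definition word_length :: "('a, 'b) monoid_scheme \<Rightarrow> 'a set \<Rightarrow> 'a \<Rightarrow> nat" where
  "word_length G S g =
     (LEAST n. \<exists>ws. set ws \<subseteq> S \<and> length ws = n \<and> foldr (\<otimes>\<^bsub>G\<^esub>) ws \<one>\<^bsub>G\<^esub> = g)"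

definition word_dist :: "('a, 'b) monoid_scheme \<Rightarrow> 'a set \<Rightarrow> 'a \<Rightarrow> 'a \<Rightarrow> nat" where
  "word_dist G S x y = word_length G S (inv\<^bsub>G\<^esub> x \<otimes>\<^bsub>G\<^esub> y)"

definition lipschitz_Lp :: "real \<Rightarrow> ('a, 'b) monoid_scheme \<Rightarrow> 'a set \<Rightarrow> ('a \<Rightarrow> L0) \<Rightarrow> bool" where
  "lipschitz_Lp p G S f \<longleftrightarrow>
     (\<exists>C. \<forall>x\<in>carrier G. \<forall>y\<in>carrier G. Lp_norm p (f x - f y) \<le> C * real (word_dist G S x y))"

text \<open>The supremum is taken in the extended reals, since it is infinite for finite groups.\<close>

definition equivariant_compression :: "real \<Rightarrow> ('a, 'b) monoid_scheme \<Rightarrow> 'a set \<Rightarrow> ereal" where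
  "equivariant_compression p G S =
     (SUP \<alpha> \<in> {\<alpha>. 0 \<le> \<alpha> \<and>
        (\<exists>f. equivariant_Lp p G f \<and> lipschitz_Lp p G S f \<and>
          (\<exists>c>0. \<forall>x\<in>carrier G. \<forall>y\<in>carrier G. x \<noteq> y \<longrightarrow>
             Lp_norm p (f x - f y) \<ge> c * real (word_dist G S x y) powr \<alpha>))}. ereal \<alpha>)"


section \<open>Free groups\<close>

text \<open>The letter \<open>(a, True)\<close> stands for the generator \<open>a\<close>, and \<open>(a, False)\<close> for its inverse. Elements
  are reduced words; \<open>push_letter\<close> multiplies a reduced word by a letter from the left.\<close>

definition inv_letter :: "'a \<times> bool \<Rightarrow> 'a \<times> bool" where
  "inv_letter l = (fst l, \<not> snd l)"

definition reduced_word :: "('a \<times> bool) list \<Rightarrow> bool" where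
  "reduced_word w \<longleftrightarrow> successively (\<lambda>x y. y \<noteq> inv_letter x) w"

fun push_letter :: "'a \<times> bool \<Rightarrow> ('a \<times> bool) list \<Rightarrow> ('a \<times> bool) list" where
  "push_letter x [] = [x]"
| "push_letter x (y # w) = (if y = inv_letter x then w else x # y # w)"

definition free_group :: "'a set \<Rightarrow> ('a \<times> bool) list monoid" where
  "free_group A =
     \<lparr>carrier = {w \<in> lists (A \<times> UNIV). reduced_word w}, monoid.mult = foldr push_letter, one = []\<rparr>"

definition F2 :: "(bool \<times> bool) list monoid" where
  "F2 = free_group UNIV"

lemma inv_letter_inv_letter [simp]: "inv_letter (inv_letter x) = x"
  by (simp add: inv_letter_def)

lemma inv_letter_eq_iff: "inv_letter x = y \<longleftrightarrow> x = inv_letter y"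
  by auto

lemma reduced_Nil [simp]: "reduced_word []"
  by (simp add: reduced_word_def)

lemma reduced_Cons: "reduced_word (x # w) \<longleftrightarrow> (w = [] \<or> hd w \<noteq> inv_letter x) \<and> reduced_word w"
  by (auto simp: reduced_word_def successively_Cons)

lemma reduced_push_letter: "reduced_word w \<Longrightarrow> reduced_word (push_letter x w)"
  by (cases w) (auto simp: reduced_Cons)

lemma push_letter_cancel:
  assumes "reduced_word w"
  shows "push_letter x (push_letter (inv_letter x) w) = w"
proof (cases w)
  case (Cons y v)
  then show ?thesis
    using assms by (cases v) (auto simp: reduced_Cons)
qed simp

lemma reduced_foldr_push_letter: "reduced_word v \<Longrightarrow> reduced_word (foldr push_letter u v)"
  by (induction u) (auto intro: reduced_push_letter)

lemma foldr_push_letter_Nil: "reduced_word u \<Longrightarrow> foldr push_letter u [] = u"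
proof (induction u)
  case (Cons x u)
  then show ?case by (cases u) (auto simp: reduced_Cons)
qed simp

lemma foldr_push_letter_push:
  assumes "reduced_word u" "reduced_word v"
  shows "foldr push_letter (push_letter x u) v = push_letter x (foldr push_letter u v)"
proof (cases u)
  case (Cons y w)
  then show ?thesis
    using push_letter_cancel[OF reduced_foldr_push_letter[OF assms(2)], of x w] by auto
qed simp

lemma foldr_push_letter_assoc:
  assumes "reduced_word v" "reduced_word w"
  shows "foldr push_letter (foldr push_letter u v) w = foldr push_letter u (foldr push_letter v w)"
  by (induction u)
    (simp_all add: foldr_push_letter_push reduced_foldr_push_letter assms)

lemma reduced_rev_inv: "reduced_word w \<Longrightarrow> reduced_word (rev (map inv_letter w))"
  unfolding reduced_word_def successively_rev successively_map
  by (erule successively_mono) (auto simp: inv_letter_eq_iff)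

lemma foldr_push_letter_inv: "foldr push_letter (rev (map inv_letter w)) w = []"
  by (induction w) simp_all

lemma push_letter_lists:
  "x \<in> A \<times> UNIV \<Longrightarrow> w \<in> lists (A \<times> UNIV) \<Longrightarrow> push_letter x w \<in> lists (A \<times> UNIV)"
  by (cases w) auto

lemma foldr_push_letter_lists:
  "u \<in> lists (A \<times> UNIV) \<Longrightarrow> v \<in> lists (A \<times> UNIV) \<Longrightarrow>
   foldr push_letter u v \<in> lists (A \<times> UNIV)"
proof (induction u)
  case (Cons x u)
  then have "x \<in> A \<times> UNIV" "foldr push_letter u v \<in> lists (A \<times> UNIV)" by auto
  from push_letter_lists[OF this] show ?case by simp
qed simp

lemma group_free_group: "group (free_group A)"
proof (rule groupI)
  fix u assume u: "u \<in> carrier (free_group A)"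
  then have "rev (map inv_letter u) \<in> carrier (free_group A)"
    by (auto simp: free_group_def reduced_rev_inv inv_letter_def in_lists_conv_set)
  then show "\<exists>y\<in>carrier (free_group A). y \<otimes>\<^bsub>free_group A\<^esub> u = \<one>\<^bsub>free_group A\<^esub>"
    by (intro bexI) (simp_all add: free_group_def foldr_push_letter_inv)
next
  fix u v assume "u \<in> carrier (free_group A)" "v \<in> carrier (free_group A)"
  then show "u \<otimes>\<^bsub>free_group A\<^esub> v \<in> carrier (free_group A)"
    using foldr_push_letter_lists[of u A v]
    by (simp add: free_group_def reduced_foldr_push_letter del: in_lists_conv_set)
qed (auto simp: free_group_def foldr_push_letter_assoc)

lemma finite_symmetric_generating_F2:
  "finite_symmetric_generating F2 (range (\<lambda>l. [l]))"
proof -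
  interpret group F2
    unfolding F2_def by (rule group_free_group)
  have carr: "carrier F2 = {w. reduced_word w}"
    by (simp add: F2_def free_group_def)
  let ?S = "range (\<lambda>l :: bool \<times> bool. [l])"
  have sub: "?S \<subseteq> carrier F2"
    by (auto simp: carr reduced_Cons)
  have inv: "inv\<^bsub>F2\<^esub> [l] = [inv_letter l]" for l
    by (rule inv_equality)
      (auto simp: carr reduced_Cons F2_def free_group_def)
  have "w \<in> generate F2 ?S" if "reduced_word w" for w
    using that
  proof (induction w)
    case Nil
    then show ?case
      using generate.one[of F2 ?S] by (simp add: F2_def free_group_def)
  next
    case (Cons x w)
    then have "[x] \<otimes>\<^bsub>F2\<^esub> w \<in> generate F2 ?S"
      by (intro generate.eng[OF generate.incl]) (auto simp: reduced_Cons)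
    moreover have "[x] \<otimes>\<^bsub>F2\<^esub> w = x # w"
      using Cons.prems by (cases w) (auto simp: F2_def free_group_def reduced_Cons)
    ultimately show ?case by simp
  qed
  then have "generate F2 ?S = carrier F2"
    using generate_in_carrier[OF sub] carr by blast
  then show ?thesis
    using sub inv by (auto simp: finite_symmetric_generating_def)
qed

end

theory Submission
  imports Defs
begin

text \<open>
  The upper bound compares a random walk in the group with the norm of a cocycle along it. An
  equivariant map differs from a cocycle \<open>b\<close> by a constant, so lower bounds on distances are lower
  bounds on \<open>b\<close>. Along the simple random walk \<open>W\<close> the vector \<open>b W\<close> is the sum of a martingale and a
  drift. The cocycle of the inverse walk has the same drift, seen from the other end, and
  \<open>\<pi> (W) (b (W\<inverse>)) = - b W\<close>; hence \<open>2 b W\<close> is a difference of two vectors distributed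
  like martingales with bounded increments, up to a bounded error (\<open>forward_backward\<close>). A scalar
  inequality integrated over the unit interval (\<open>powr_add_le_linear\<close>, \<open>Lp_pow_step\<close>) shows that the
  \<open>p\<close>-th moment of such a martingale after \<open>n\<close> steps is at most a multiple of \<open>n powr max 1 (p / 2)\<close>
  (\<open>cocycle_moment_growth\<close>). In the free group the walk has positive speed, so a compression exponent
  \<open>\<alpha>\<close> makes this moment at least a multiple of \<open>n powr (\<alpha> * p)\<close>, and \<open>\<alpha> * p \<le> max 1 (p / 2)\<close>
  (\<open>compression_exponent_le\<close>).

  For the lower bound it suffices to permute coordinates. Homotheties between the dyadic shells of the
  unit interval turn every permutation of the natural numbers into an isometry of $L_p$, compatibly
  with an isometric copy of $\ell_p$ (\<open>shell_op\<close>, \<open>shell_vec\<close>). Thus actions on countable sets,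
  together with cocycles in $\ell_p$ of these sets, give affine isometric actions on $L_p$
  (\<open>compression_ge_of_lp_action\<close>). The free group acts on each finite ball of its tree by completing
  the partial left translations to permutations, and the signed edge path from the root to \<open>w\<close> is a
  cocycle with \<open>length w\<close> entries \<open>\<plusminus> 1\<close> as long as \<open>w\<close> stays in the ball (\<open>flow_properties\<close>).
  Its \<open>p\<close>-th power norm is \<open>length w\<close>, which gives the exponent \<open>1 / p\<close> (\<open>ball_model_edges\<close>). For
  \<open>p \<ge> 2\<close> the edges are replaced by independent signs on the finite cube of all sign patterns: the sum
  of the signs along the path has second moment \<open>length w\<close>, hence \<open>p\<close>-th moment at least a multiple of
  \<open>length w powr (p / 2)\<close>, which gives the exponent \<open>1 / 2\<close> (\<open>ball_model_signs\<close>). Balls of radius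
  \<open>2 ^ k\<close> are combined with weights \<open>2 powr (- \<epsilon> * k)\<close>, at the cost of an arbitrarily small loss in the
  exponent (\<open>compression_ge_of_ball_models\<close>).
\<close>

section \<open>Functions modulo null sets\<close>

lemma rep_L0_measurable [measurable]: "rep_L0 u \<in> borel_measurable unit_leb"
  using Quotient3_rep_reflp[OF Quotient3_L0, of u] by (simp add: ae_eq_def)

lemma rep_abs_L0:
  assumes "f \<in> borel_measurable unit_leb"
  shows "AE t in unit_leb. rep_L0 (abs_L0 f) t = f t"
  using rep_abs_rsp_left[OF Quotient3_L0, of f f] assms by (simp add: ae_eq_def)

lemma L0_eqI:
  assumes "AE t in unit_leb. rep_L0 u t = rep_L0 v t"
  shows "u = v"
  using Quotient3_rel_rep[OF Quotient3_L0, of u v] assms by (simp add: ae_eq_def)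

lemma rep_L0_zero: "AE t in unit_leb. rep_L0 0 t = 0"
  unfolding zero_L0_def by (rule rep_abs_L0) simp

lemma rep_L0_add: "AE t in unit_leb. rep_L0 (u + v) t = rep_L0 u t + rep_L0 v t"
proof -
  have "u + v = abs_L0 (\<lambda>t. rep_L0 u t + rep_L0 v t)"
    by (simp add: plus_L0_def)
  then show ?thesis
    using rep_abs_L0[of "\<lambda>t. rep_L0 u t + rep_L0 v t"] by simp
qed

lemma rep_L0_scaleR: "AE t in unit_leb. rep_L0 (c *\<^sub>R u) t = c * rep_L0 u t"
proof -
  have "c *\<^sub>R u = abs_L0 (\<lambda>t. c * rep_L0 u t)"
    by (simp add: scaleR_L0_def)
  then show ?thesis
    using rep_abs_L0[of "\<lambda>t. c * rep_L0 u t"] by simp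
qed

lemma rep_L0_sum:
  assumes "finite A"
  shows "AE t in unit_leb. rep_L0 (\<Sum>s\<in>A. d s) t = (\<Sum>s\<in>A. rep_L0 (d s) t)"
  using assms
proof (induction A rule: finite_induct)
  case empty
  then show ?case using rep_L0_zero by simp
next
  case (insert a A)
  have "AE t in unit_leb. rep_L0 (d a + (\<Sum>s\<in>A. d s)) t = rep_L0 (d a) t + rep_L0 (\<Sum>s\<in>A. d s) t"
    by (rule rep_L0_add)
  with insert.IH show ?case
    using insert.hyps by (auto elim: eventually_elim2)
qed

definition Lp_pow :: "real \<Rightarrow> L0 \<Rightarrow> real" where
  "Lp_pow p u = (\<integral>t. \<bar>rep_L0 u t\<bar> powr p \<partial>unit_leb)"

lemma Lp_norm_eq: "Lp_norm p u = Lp_pow p u powr (1 / p)"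
  by (simp add: Lp_norm_def Lp_pow_def)

lemma Lp_pow_nonneg [simp]: "0 \<le> Lp_pow p u"
  unfolding Lp_pow_def by (rule integral_nonneg_AE) simp

lemma Lp_norm_nonneg [simp]: "0 \<le> Lp_norm p u"
  by (simp add: Lp_norm_eq)

lemma Lp_pow_eq: "p > 0 \<Longrightarrow> Lp_pow p u = Lp_norm p u powr p"
  by (simp add: Lp_norm_eq powr_powr)

lemma Lp_iff: "u \<in> Lp p \<longleftrightarrow> integrable unit_leb (\<lambda>t. \<bar>rep_L0 u t\<bar> powr p)"
  by (simp add: Lp_def p_integrable_def)

lemma Lp_pow_cong_AE:
  assumes "AE t in unit_leb. \<bar>rep_L0 u t\<bar> = \<bar>rep_L0 v t\<bar>"
  shows "Lp_pow p u = Lp_pow p v"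
  unfolding Lp_pow_def
  by (rule integral_cong_AE) (use assms in \<open>auto elim: eventually_mono\<close>)

lemma Lp_scaleR:
  assumes "u \<in> Lp p"
  shows "c *\<^sub>R u \<in> Lp p" and "Lp_pow p (c *\<^sub>R u) = \<bar>c\<bar> powr p * Lp_pow p u"
proof -
  have ae: "AE t in unit_leb. \<bar>rep_L0 (c *\<^sub>R u) t\<bar> powr p = \<bar>c\<bar> powr p * \<bar>rep_L0 u t\<bar> powr p"
    using rep_L0_scaleR[of c u] by eventually_elim (simp add: abs_mult powr_mult)
  have i: "integrable unit_leb (\<lambda>t. \<bar>c\<bar> powr p * \<bar>rep_L0 u t\<bar> powr p)"
    using assms by (simp add: Lp_iff)
  show "c *\<^sub>R u \<in> Lp p"
    unfolding Lp_iff by (rule integrable_cong_AE_imp[OF i]) (use ae in \<open>auto elim: eventually_mono\<close>)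
  show "Lp_pow p (c *\<^sub>R u) = \<bar>c\<bar> powr p * Lp_pow p u"
    unfolding Lp_pow_def integral_mult_right_zero[symmetric]
    by (rule integral_cong_AE) (use ae in auto)
qed

lemma Lp_uminus_iff: "- u \<in> Lp p \<longleftrightarrow> u \<in> Lp p"
  using Lp_scaleR(1)[of u p "-1"] Lp_scaleR(1)[of "-u" p "-1"] by auto

lemma Lp_pow_uminus: "Lp_pow p (- u) = Lp_pow p u"
  by (rule Lp_pow_cong_AE)
     (use rep_L0_scaleR[of "-1" u] in \<open>auto elim: eventually_mono\<close>)

lemma Lp_zero: "0 \<in> Lp p" and Lp_pow_zero: "p > 0 \<Longrightarrow> Lp_pow p 0 = 0"
proof -
  have ae: "AE t in unit_leb. \<bar>rep_L0 0 t\<bar> powr p = 0"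
    using rep_L0_zero by eventually_elim simp
  have i: "integrable unit_leb (\<lambda>t. 0 :: real)" by simp
  show "0 \<in> Lp p"
    unfolding Lp_iff by (rule integrable_cong_AE_imp[OF i]) (use ae in \<open>auto elim: eventually_mono\<close>)
  show "Lp_pow p 0 = 0"
    unfolding Lp_pow_def by (subst integral_cong_AE[OF _ _ ae]) auto
qed

text \<open>Convexity of the power function at \<open>a + b = l * (a / l) + (1 - l) * (b / (1 - l))\<close>. The
  free weight is what makes the inequality useful: \<open>l = 1 / 2\<close> shows that $L_p$ is closed under
  addition, and weights proportional to the norms give Minkowski's inequality.\<close>

lemma powr_add_convex:
  fixes a b p l :: real
  assumes p: "1 \<le> p" and l: "0 < l" "l < 1"
  shows "\<bar>a + b\<bar> powr p \<le> l powr (1 - p) * \<bar>a\<bar> powr p + (1 - l) powr (1 - p) * \<bar>b\<bar> powr p"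
proof (cases "a = 0 \<or> b = 0")
  case True
  have "1 \<le> l powr (1 - p)" "1 \<le> (1 - l) powr (1 - p)"
    using powr_mono'[of "1 - p" 0 l] powr_mono'[of "1 - p" 0 "1 - l"] p l by auto
  then have "1 * \<bar>a\<bar> powr p \<le> l powr (1 - p) * \<bar>a\<bar> powr p"
    "1 * \<bar>b\<bar> powr p \<le> (1 - l) powr (1 - p) * \<bar>b\<bar> powr p"
    by (intro mult_right_mono; simp)+
  then show ?thesis using True p by auto
next
  case False
  have *: "x * (\<bar>c\<bar> / x) powr p = x powr (1 - p) * \<bar>c\<bar> powr p" if "0 < x" for x c :: real
    using that by (simp add: powr_divide powr_diff)
  have "\<bar>a + b\<bar> powr p \<le> (\<bar>a\<bar> + \<bar>b\<bar>) powr p"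
    by (rule powr_mono2) (use p in auto)
  also have "\<bar>a\<bar> + \<bar>b\<bar> = l * (\<bar>a\<bar> / l) + (1 - l) * (\<bar>b\<bar> / (1 - l))"
    using l by simp
  also have "\<dots> powr p \<le> l * (\<bar>a\<bar> / l) powr p + (1 - l) * (\<bar>b\<bar> / (1 - l)) powr p"
    using convex_onD[OF powr_convex[OF p], of "1 - l" "\<bar>a\<bar> / l" "\<bar>b\<bar> / (1 - l)"] l False
    by simp
  finally show ?thesis using *[of l a] *[of "1 - l" b] l by simp
qed

lemma Lp_add_convex:
  assumes p: "1 \<le> p" and l: "0 < l" "l < 1" and uv: "u \<in> Lp p" "v \<in> Lp p"
  shows "u + v \<in> Lp p"
    and "Lp_pow p (u + v) \<le> l powr (1 - p) * Lp_pow p u + (1 - l) powr (1 - p) * Lp_pow p v"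
proof -
  let ?F = "\<lambda>t. l powr (1 - p) * \<bar>rep_L0 u t\<bar> powr p + (1 - l) powr (1 - p) * \<bar>rep_L0 v t\<bar> powr p"
  have ae: "AE t in unit_leb. \<bar>rep_L0 (u + v) t\<bar> powr p \<le> ?F t"
    using rep_L0_add[of u v] by eventually_elim (use powr_add_convex[OF p l] in simp)
  have iu: "integrable unit_leb (\<lambda>t. l powr (1 - p) * \<bar>rep_L0 u t\<bar> powr p)"
    and iv: "integrable unit_leb (\<lambda>t. (1 - l) powr (1 - p) * \<bar>rep_L0 v t\<bar> powr p)"
    using uv by (auto simp: Lp_iff)
  have i: "integrable unit_leb ?F"
    using iu iv by (rule Bochner_Integration.integrable_add)
  show uv': "u + v \<in> Lp p"
    unfolding Lp_iff
    by (rule Bochner_Integration.integrable_bound[OF i])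
      (use ae in \<open>auto elim!: eventually_mono\<close>)
  have "Lp_pow p (u + v) \<le> (\<integral>t. ?F t \<partial>unit_leb)"
    unfolding Lp_pow_def by (rule integral_mono_AE) (use uv' i ae in \<open>auto simp: Lp_iff\<close>)
  also have "\<dots> = l powr (1 - p) * Lp_pow p u + (1 - l) powr (1 - p) * Lp_pow p v"
    unfolding Lp_pow_def Bochner_Integration.integral_add[OF iu iv] by simp
  finally show "Lp_pow p (u + v) \<le> l powr (1 - p) * Lp_pow p u + (1 - l) powr (1 - p) * Lp_pow p v" .
qed

lemma Lp_add: "1 \<le> p \<Longrightarrow> u \<in> Lp p \<Longrightarrow> v \<in> Lp p \<Longrightarrow> u + v \<in> Lp p"
  using Lp_add_convex(1)[of p "1/2"] by simp

lemma Lp_diff: "1 \<le> p \<Longrightarrow> u \<in> Lp p \<Longrightarrow> v \<in> Lp p \<Longrightarrow> u - v \<in> Lp p"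
  using Lp_add[of p u "- v"] by (simp add: Lp_uminus_iff)

lemma Lp_sum: "1 \<le> p \<Longrightarrow> (\<And>s. s \<in> A \<Longrightarrow> d s \<in> Lp p) \<Longrightarrow> (\<Sum>s\<in>A. d s) \<in> Lp p"
  by (induction A rule: infinite_finite_induct) (auto intro: Lp_add Lp_zero)

lemma Lp_pow_add_le:
  assumes "1 \<le> p" "u \<in> Lp p" "v \<in> Lp p"
  shows "Lp_pow p (u + v) \<le> 2 powr p * (Lp_pow p u + Lp_pow p v)"
proof -
  have "(1 / 2) powr (1 - p) \<le> (2 :: real) powr p"
    by (simp add: powr_divide powr_diff)
  then have "(1 / 2) powr (1 - p) * (Lp_pow p u + Lp_pow p v) \<le> 2 powr p * (Lp_pow p u + Lp_pow p v)"
    by (intro mult_right_mono) auto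
  then show ?thesis
    using Lp_add_convex(2)[OF assms(1), of "1/2" u v] assms by (simp add: algebra_simps)
qed

lemma Lp_norm_triangle:
  assumes p: "1 \<le> p" and uv: "u \<in> Lp p" "v \<in> Lp p"
  shows "Lp_norm p (u + v) \<le> Lp_norm p u + Lp_norm p v"
proof -
  \<comment> \<open>Strictly positive bounds instead of the norms, so that the weight lies strictly between 0 and 1.\<close>
  have *: "Lp_norm p (u + v) \<le> A + B"
    if A: "Lp_norm p u \<le> A" "0 < A" and B: "Lp_norm p v \<le> B" "0 < B" for A B
  proof -
    define l where "l = A / (A + B)"
    have l: "0 < l" "l < 1" and l': "1 - l = B / (A + B)"
      using A B by (auto simp: l_def field_simps)
    have e: "(x / (A + B)) powr (1 - p) * x powr p = (A + B) powr (p - 1) * x" if "0 < x" for x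
    proof -
      have "x powr (1 - p) * x powr p = x"
        using that by (simp flip: powr_add)
      moreover have "(A + B) powr (p - 1) * (A + B) powr (1 - p) = 1"
        using A B by (simp flip: powr_add)
      ultimately show ?thesis
        using that A B by (simp add: powr_divide field_simps)
    qed
    have "Lp_pow p (u + v) \<le> l powr (1 - p) * Lp_pow p u + (1 - l) powr (1 - p) * Lp_pow p v"
      by (rule Lp_add_convex(2)[OF p l uv])
    also have "\<dots> \<le> l powr (1 - p) * A powr p + (1 - l) powr (1 - p) * B powr p"
      unfolding Lp_pow_eq[OF less_le_trans[OF zero_less_one p]]
      by (intro add_mono mult_left_mono powr_mono2) (use A B p in auto)
    also have "\<dots> = (A + B) powr (p - 1) * A + (A + B) powr (p - 1) * B"
      using e[of A] e[of B] A B unfolding l' by (simp add: l_def)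
    also have "\<dots> = (A + B) powr p"
      using A B by (simp add: powr_diff field_simps flip: add_divide_distrib)
    finally have "Lp_norm p (u + v) \<le> ((A + B) powr p) powr (1 / p)"
      unfolding Lp_norm_eq by (intro powr_mono2) (use p in auto)
    then show ?thesis using p A B by (simp add: powr_powr)
  qed
  show ?thesis
  proof (rule field_le_epsilon)
    fix e :: real assume "0 < e"
    then show "Lp_norm p (u + v) \<le> Lp_norm p u + Lp_norm p v + e"
      using *[of "Lp_norm p u + e / 2" "Lp_norm p v + e / 2"]
        Lp_norm_nonneg[of p u] Lp_norm_nonneg[of p v] by simp
  qed
qed

section \<open>One step of a martingale in $L_p$\<close>

lemma exp_le_quadratic: "exp y \<le> 1 + y + exp \<bar>y\<bar> * y\<^sup>2" for y :: real
proof -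
  obtain t where t: "\<bar>t\<bar> \<le> \<bar>y\<bar>" "exp y = (\<Sum>m<2. y ^ m / fact m) + (exp t / fact 2) * y ^ 2"
    using Maclaurin_exp_le by blast
  have "exp t \<le> exp \<bar>y\<bar>" using t(1) by simp
  then have "exp t / 2 \<le> exp \<bar>y\<bar>" using exp_ge_zero[of t] by linarith
  then have "exp t / 2 * y ^ 2 \<le> exp \<bar>y\<bar> * y ^ 2"
    by (intro mult_right_mono) auto
  then show ?thesis using t(2) by (simp add: numeral_2_eq_2)
qed

text \<open>An expansion to first order whose linear term will cancel, since martingale increments are
  centred. For \<open>p \<le> 2\<close> the error is of order \<open>\<bar>b\<bar> powr p\<close>. For \<open>p > 2\<close> there is a further error of order
  \<open>\<bar>a\<bar> powr (p - 2) * b\<^sup>2\<close>, which is split between \<open>\<bar>a\<bar> powr p\<close> and \<open>\<bar>b\<bar> powr p\<close>. The parameter \<open>m\<close> governs this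
  split and will be the number of steps: the factors \<open>1 + C / m\<close> then stay bounded when multiplied
  over all steps. At \<open>a = 0\<close> the linear coefficient is zero by the convention for division.\<close>

lemma powr_add_le_linear:
  fixes p :: real
  assumes p: "1 \<le> p"
  obtains C where "0 \<le> C" and
    "\<And>m a b. 1 \<le> m \<Longrightarrow> \<bar>a + b\<bar> powr p \<le>
       (1 + C / m) * \<bar>a\<bar> powr p + p * \<bar>a\<bar> powr p / a * b + C * m powr (max 1 (p / 2) - 1) * \<bar>b\<bar> powr p"
proof -
  define r where "r = max 1 (p / 2)"
  define C where "C = max (exp p * p\<^sup>2) (3 powr p + p * 2 powr p)"
  have C: "exp p * p\<^sup>2 \<le> C" "3 powr p + p * 2 powr p \<le> C" "0 \<le> C"
    by (auto simp: C_def le_max_iff_disj)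
  \<comment> \<open>The case \<open>a = 1\<close>; the general case follows by homogeneity.\<close>
  have unit: "\<bar>1 + x\<bar> powr p \<le> 1 + C / m + p * x + C * m powr (r - 1) * \<bar>x\<bar> powr p"
    if m: "1 \<le> m" for m x :: real
  proof -
    have m1: "1 \<le> m powr (r - 1)"
      using m by (intro ge_one_powr_ge_zero) (auto simp: r_def)
    show ?thesis
    proof (cases "1 / 2 \<le> \<bar>x\<bar>")
      case True
      have "\<bar>1 + x\<bar> powr p \<le> (3 * \<bar>x\<bar>) powr p"
        using True p by (intro powr_mono2) auto
      also have "\<dots> = 3 powr p * \<bar>x\<bar> powr p" by (simp add: powr_mult)
      finally have 1: "\<bar>1 + x\<bar> powr p \<le> 3 powr p * \<bar>x\<bar> powr p" .
      have "- x \<le> (2 * \<bar>x\<bar>) powr 1" using True by auto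
      also have "\<dots> \<le> (2 * \<bar>x\<bar>) powr p" using True p by (intro powr_mono) auto
      also have "\<dots> = 2 powr p * \<bar>x\<bar> powr p" by (simp add: powr_mult)
      finally have "p * (- x) \<le> p * (2 powr p * \<bar>x\<bar> powr p)"
        using p by (intro mult_left_mono) auto
      with 1 have "\<bar>1 + x\<bar> powr p \<le> p * x + (3 powr p + p * 2 powr p) * \<bar>x\<bar> powr p"
        by (simp add: algebra_simps)
      also have "\<dots> \<le> p * x + C * 1 * \<bar>x\<bar> powr p"
        using C by (intro add_left_mono mult_right_mono) auto
      also have "\<dots> \<le> p * x + C * m powr (r - 1) * \<bar>x\<bar> powr p"
        using C m1 by (intro add_left_mono mult_right_mono mult_left_mono) auto
      finally have "\<bar>1 + x\<bar> powr p \<le> p * x + C * m powr (r - 1) * \<bar>x\<bar> powr p" .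
      moreover have "0 \<le> C / m" using C m by simp
      ultimately show ?thesis by linarith
    next
      case False
      have "(1 + x) powr p \<le> exp x powr p"
        using False p by (intro powr_mono2) auto
      also have "\<dots> = exp (p * x)" by (simp add: powr_def)
      also have "\<dots> \<le> 1 + p * x + exp \<bar>p * x\<bar> * (p * x)\<^sup>2" by (rule exp_le_quadratic)
      also have "\<bar>p * x\<bar> \<le> p" using False p by (auto simp: abs_mult)
      then have "exp \<bar>p * x\<bar> * (p * x)\<^sup>2 \<le> exp p * (p * x)\<^sup>2"
        by (intro mult_right_mono) auto
      also have "exp p * (p * x)\<^sup>2 = exp p * p\<^sup>2 * x\<^sup>2" by (simp add: power_mult_distrib)
      also have "\<dots> \<le> C * x\<^sup>2" using C by (intro mult_right_mono) auto
      finally have 1: "(1 + x) powr p \<le> 1 + p * x + C * x\<^sup>2" by simp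
      \<comment> \<open>If the first summand is too small, then \<open>m * x\<^sup>2 \<ge> 1\<close>, and raising this to the power
        \<open>r - 1 = p / 2 - 1\<close> gains the missing factor.\<close>
      have "x\<^sup>2 \<le> 1 / m + m powr (r - 1) * \<bar>x\<bar> powr p"
      proof (cases "p \<le> 2 \<or> x = 0")
        case True
        have "x\<^sup>2 \<le> \<bar>x\<bar> powr p"
        proof (cases "x = 0")
          case False
          then have "x\<^sup>2 = \<bar>x\<bar> powr 2" by simp
          also have "\<dots> \<le> \<bar>x\<bar> powr p"
            using \<open>\<not> 1 / 2 \<le> \<bar>x\<bar>\<close> True False by (intro powr_mono') auto
          finally show ?thesis .
        qed simp
        also have "\<dots> \<le> m powr (r - 1) * \<bar>x\<bar> powr p"
          using mult_right_mono[OF m1, of "\<bar>x\<bar> powr p"] by simp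
        finally show ?thesis using m by (simp add: add_increasing)
      next
        case ne: False
        show ?thesis
        proof (cases "x\<^sup>2 \<le> 1 / m")
          case True
          then show ?thesis by (simp add: add_increasing2)
        next
          case False
          then have "1 \<le> m * x\<^sup>2" using m by (simp add: field_simps)
          then have "x\<^sup>2 * 1 \<le> x\<^sup>2 * (m * x\<^sup>2) powr (r - 1)"
            by (intro mult_left_mono ge_one_powr_ge_zero) (auto simp: r_def)
          also have "\<dots> = m powr (r - 1) * (\<bar>x\<bar> powr 2 * (\<bar>x\<bar> powr 2) powr (r - 1))"
            using m ne by (simp add: powr_mult)
          also have "\<bar>x\<bar> powr 2 * (\<bar>x\<bar> powr 2) powr (r - 1) = \<bar>x\<bar> powr p"
            using ne by (simp add: r_def powr_powr flip: powr_add del: powr_numeral)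
          finally show ?thesis using m by (simp add: add_increasing)
        qed
      qed
      then have "C * x\<^sup>2 \<le> C * (1 / m + m powr (r - 1) * \<bar>x\<bar> powr p)"
        using C by (intro mult_left_mono) auto
      moreover have "\<bar>1 + x\<bar> = 1 + x" using False by auto
      moreover note 1
      ultimately show ?thesis by (simp add: algebra_simps)
    qed
  qed
  show thesis
  proof (rule that[OF C(3)])
    fix m a b :: real assume m: "1 \<le> m"
    show "\<bar>a + b\<bar> powr p \<le>
       (1 + C / m) * \<bar>a\<bar> powr p + p * \<bar>a\<bar> powr p / a * b + C * m powr (max 1 (p / 2) - 1) * \<bar>b\<bar> powr p"
    proof (cases "a = 0")
      case True
      have "1 * 1 \<le> C * m powr (r - 1)"
      proof (rule mult_mono)
        have "1 \<le> (3::real) powr p" using p by (intro ge_one_powr_ge_zero) auto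
        moreover have "0 \<le> p * 2 powr p" using p by simp
        ultimately show "1 \<le> C" using C(2) by linarith
        show "1 \<le> m powr (r - 1)"
          using m by (intro ge_one_powr_ge_zero) (auto simp: r_def)
      qed (use C in auto)
      then have "1 * \<bar>b\<bar> powr p \<le> C * m powr (r - 1) * \<bar>b\<bar> powr p"
        by (intro mult_right_mono) auto
      then show ?thesis using True p by (simp add: r_def)
    next
      case False
      have "\<bar>a + b\<bar> powr p = \<bar>a\<bar> powr p * \<bar>1 + b / a\<bar> powr p"
        using False by (simp add: add_divide_distrib distrib_left flip: powr_mult abs_mult)
      also have "\<dots> \<le> \<bar>a\<bar> powr p * (1 + C / m + p * (b / a) + C * m powr (r - 1) * \<bar>b / a\<bar> powr p)"
        by (intro mult_left_mono unit[OF m]) auto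
      also have "\<dots> = (1 + C / m) * \<bar>a\<bar> powr p + p * \<bar>a\<bar> powr p / a * b
          + C * m powr (r - 1) * (\<bar>a\<bar> powr p * \<bar>b / a\<bar> powr p)"
        by (simp add: algebra_simps)
      also have "\<bar>a\<bar> powr p * \<bar>b / a\<bar> powr p = \<bar>b\<bar> powr p"
        using False by (simp add: powr_divide)
      finally show ?thesis by (simp add: r_def)
    qed
  qed
qed

text \<open>The scalar inequality holds at almost every point with increments that sum to zero there, so the
  linear term disappears before integration and never has to be integrable.\<close>

lemma Lp_pow_step:
  fixes p :: real
  assumes p: "1 \<le> p"
  obtains C where "0 \<le> C" and
    "\<And>m A u d. 1 \<le> m \<Longrightarrow> finite A \<Longrightarrow> u \<in> Lp p \<Longrightarrow> (\<And>s. s \<in> A \<Longrightarrow> d s \<in> Lp p) \<Longrightarrow>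
       (\<Sum>s\<in>A. d s) = 0 \<Longrightarrow>
       (\<Sum>s\<in>A. Lp_pow p (u + d s)) \<le> (1 + C / m) * (real (card A) * Lp_pow p u)
          + C * m powr (max 1 (p / 2) - 1) * (\<Sum>s\<in>A. Lp_pow p (d s))"
proof -
  obtain C where C: "0 \<le> C" and
    ineq: "\<And>m a b. 1 \<le> m \<Longrightarrow> \<bar>a + b\<bar> powr p \<le>
       (1 + C / m) * \<bar>a\<bar> powr p + p * \<bar>a\<bar> powr p / a * b + C * m powr (max 1 (p / 2) - 1) * \<bar>b\<bar> powr p"
    using powr_add_le_linear[OF p] by blast
  show thesis
  proof (rule that[OF C])
    fix m :: real and A :: "'a set" and u :: L0 and d :: "'a \<Rightarrow> L0"
    assume m: "1 \<le> m" and A: "finite A" and u: "u \<in> Lp p" and d: "\<And>s. s \<in> A \<Longrightarrow> d s \<in> Lp p"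
      and sum0: "(\<Sum>s\<in>A. d s) = 0"
    define K where "K = C * m powr (max 1 (p / 2) - 1)"
    let ?F = "\<lambda>t. (1 + C / m) * real (card A) * \<bar>rep_L0 u t\<bar> powr p + K * (\<Sum>s\<in>A. \<bar>rep_L0 (d s) t\<bar> powr p)"
    have "AE t in unit_leb. \<forall>s\<in>A. rep_L0 (u + d s) t = rep_L0 u t + rep_L0 (d s) t"
      using A by (intro AE_finite_allI rep_L0_add)
    moreover have "AE t in unit_leb. (\<Sum>s\<in>A. rep_L0 (d s) t) = 0"
      using rep_L0_sum[OF A, of d] rep_L0_zero unfolding sum0 by eventually_elim simp
    ultimately have ae: "AE t in unit_leb. (\<Sum>s\<in>A. \<bar>rep_L0 (u + d s) t\<bar> powr p) \<le> ?F t"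
    proof eventually_elim
      case (elim t)
      have "(\<Sum>s\<in>A. \<bar>rep_L0 (u + d s) t\<bar> powr p) \<le> (\<Sum>s\<in>A. (1 + C / m) * \<bar>rep_L0 u t\<bar> powr p
          + p * \<bar>rep_L0 u t\<bar> powr p / rep_L0 u t * rep_L0 (d s) t + K * \<bar>rep_L0 (d s) t\<bar> powr p)"
        unfolding K_def using elim(1) ineq[OF m] by (intro sum_mono) simp
      also have "\<dots> = ?F t + p * \<bar>rep_L0 u t\<bar> powr p / rep_L0 u t * (\<Sum>s\<in>A. rep_L0 (d s) t)"
        by (simp add: sum.distrib sum_distrib_left sum_divide_distrib algebra_simps)
      finally show ?case using elim(2) by simp
    qed
    have i1: "integrable unit_leb (\<lambda>t. (1 + C / m) * real (card A) * \<bar>rep_L0 u t\<bar> powr p)"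
      using u by (auto simp: Lp_iff)
    have i2: "integrable unit_leb (\<lambda>t. \<Sum>s\<in>A. \<bar>rep_L0 (d s) t\<bar> powr p)"
      using d by (auto simp: Lp_iff)
    then have i3: "integrable unit_leb (\<lambda>t. K * (\<Sum>s\<in>A. \<bar>rep_L0 (d s) t\<bar> powr p))"
      by simp
    have i4: "integrable unit_leb (\<lambda>t. \<bar>rep_L0 (u + d s) t\<bar> powr p)" if "s \<in> A" for s
      using Lp_add[OF p u d[OF that]] by (simp add: Lp_iff)
    have "(\<Sum>s\<in>A. Lp_pow p (u + d s)) = (\<integral>t. (\<Sum>s\<in>A. \<bar>rep_L0 (u + d s) t\<bar> powr p) \<partial>unit_leb)"
      unfolding Lp_pow_def using i4 by (subst Bochner_Integration.integral_sum) auto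
    also have "\<dots> \<le> (\<integral>t. ?F t \<partial>unit_leb)"
      by (rule integral_mono_AE[OF _ _ ae])
        (use i4 i1 i3 in \<open>auto intro!: Bochner_Integration.integrable_sum Bochner_Integration.integrable_add\<close>)
    also have "\<dots> = (1 + C / m) * real (card A) * Lp_pow p u + K * (\<Sum>s\<in>A. Lp_pow p (d s))"
      unfolding Bochner_Integration.integral_add[OF i1 i3] Lp_pow_def
      using d by (simp add: Lp_iff Bochner_Integration.integral_sum)
    finally show "(\<Sum>s\<in>A. Lp_pow p (u + d s)) \<le> (1 + C / m) * (real (card A) * Lp_pow p u)
          + C * m powr (max 1 (p / 2) - 1) * (\<Sum>s\<in>A. Lp_pow p (d s))"
      by (simp add: K_def mult.assoc)
  qed
qed

section \<open>Cocycles along a symmetric random walk\<close>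

lemma sum_lists_Suc:
  fixes F :: "'a list \<Rightarrow> real"
  shows "(\<Sum>w | set w \<subseteq> T \<and> length w = Suc n. F w)
    = (\<Sum>w | set w \<subseteq> T \<and> length w = n. \<Sum>s\<in>T. F (s # w))"
proof -
  have "inj_on (\<lambda>(w, s). s # w) ({w. set w \<subseteq> T \<and> length w = n} \<times> T)"
    by (auto simp: inj_on_def)
  then have "(\<Sum>w | set w \<subseteq> T \<and> length w = Suc n. F w)
    = (\<Sum>(w, s)\<in>{w. set w \<subseteq> T \<and> length w = n} \<times> T. F (s # w))"
    by (simp only: lists_length_Suc_eq sum.reindex) (simp add: case_prod_unfold)
  then show ?thesis
    by (simp add: sum.cartesian_product)
qed

locale Lp_cocycle = group G for G (structure) +
  fixes p :: real and \<pi> :: "'a \<Rightarrow> L0 \<Rightarrow> L0" and b :: "'a \<Rightarrow> L0"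
  assumes p: "1 \<le> p" and hom: "\<pi> \<in> hom G (Isom_Lp p)" and cocycle: "is_cocycle p G \<pi> b"
begin

lemma iso_carrier: "x \<in> carrier G \<Longrightarrow> \<pi> x \<in> carrier (Isom_Lp p)"
  using hom by (auto simp: hom_def)

lemma iso_bij: "x \<in> carrier G \<Longrightarrow> bij_betw (\<pi> x) (Lp p) (Lp p)"
  using iso_carrier by (auto simp: Isom_Lp_def Bij_def)

lemma iso_in: "x \<in> carrier G \<Longrightarrow> u \<in> Lp p \<Longrightarrow> \<pi> x u \<in> Lp p"
  using iso_bij bij_betwE by blast

lemma iso_add: "x \<in> carrier G \<Longrightarrow> u \<in> Lp p \<Longrightarrow> v \<in> Lp p \<Longrightarrow> \<pi> x (u + v) = \<pi> x u + \<pi> x v"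
  using iso_carrier by (auto simp: Isom_Lp_def)

lemma iso_scaleR: "x \<in> carrier G \<Longrightarrow> u \<in> Lp p \<Longrightarrow> \<pi> x (c *\<^sub>R u) = c *\<^sub>R \<pi> x u"
  using iso_carrier by (auto simp: Isom_Lp_def)

lemma iso_norm: "x \<in> carrier G \<Longrightarrow> u \<in> Lp p \<Longrightarrow> Lp_norm p (\<pi> x u) = Lp_norm p u"
  using iso_carrier by (auto simp: Isom_Lp_def)

lemma iso_pow: "x \<in> carrier G \<Longrightarrow> u \<in> Lp p \<Longrightarrow> Lp_pow p (\<pi> x u) = Lp_pow p u"
  using iso_norm p by (simp add: Lp_pow_eq)

lemma iso_uminus: "x \<in> carrier G \<Longrightarrow> u \<in> Lp p \<Longrightarrow> \<pi> x (- u) = - \<pi> x u"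
  using iso_scaleR[of x u "-1"] by simp

lemma iso_diff:
  "x \<in> carrier G \<Longrightarrow> u \<in> Lp p \<Longrightarrow> v \<in> Lp p \<Longrightarrow> \<pi> x (u - v) = \<pi> x u - \<pi> x v"
  using iso_add[of x u "- v"] by (simp add: iso_uminus Lp_uminus_iff)

lemma iso_zero: "x \<in> carrier G \<Longrightarrow> \<pi> x 0 = 0"
  using iso_scaleR[of x 0 0] Lp_zero by simp

lemma iso_sum:
  "x \<in> carrier G \<Longrightarrow> (\<And>s. s \<in> A \<Longrightarrow> d s \<in> Lp p) \<Longrightarrow> \<pi> x (\<Sum>s\<in>A. d s) = (\<Sum>s\<in>A. \<pi> x (d s))"
  by (induction A rule: infinite_finite_induct) (auto simp: iso_zero iso_add Lp_sum p)

lemma iso_mult: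
  assumes "x \<in> carrier G" "y \<in> carrier G" "u \<in> Lp p"
  shows "\<pi> (x \<otimes> y) u = \<pi> x (\<pi> y u)"
proof -
  have "\<pi> (x \<otimes> y) = \<pi> x \<otimes>\<^bsub>Isom_Lp p\<^esub> \<pi> y"
    using hom assms by (auto simp: hom_def)
  also have "\<dots> = compose (Lp p) (\<pi> x) (\<pi> y)"
    using iso_carrier[OF assms(1)] iso_carrier[OF assms(2)]
    by (simp add: Isom_Lp_def BijGroup_def)
  finally show ?thesis using assms by (simp add: compose_eq)
qed

lemma iso_one: "u \<in> Lp p \<Longrightarrow> \<pi> \<one> u = u"
  using iso_mult[of \<one> \<one> u] iso_bij[of \<one>] iso_in[of \<one> u]
  by (auto simp: bij_betw_def dest: inj_onD)

lemma cocycle_in: "x \<in> carrier G \<Longrightarrow> b x \<in> Lp p"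
  using cocycle by (auto simp: is_cocycle_def)

lemma cocycle_mult: "x \<in> carrier G \<Longrightarrow> y \<in> carrier G \<Longrightarrow> b (x \<otimes> y) = \<pi> x (b y) + b x"
  using cocycle by (auto simp: is_cocycle_def)

lemma cocycle_one: "b \<one> = 0"
  using cocycle_mult[of \<one> \<one>] iso_one[of "b \<one>"] cocycle_in[of \<one>] by simp

lemma cocycle_diff:
  assumes "x \<in> carrier G" "y \<in> carrier G"
  shows "b x - b y = - \<pi> x (b (inv x \<otimes> y))"
  using cocycle_mult[of x "inv x \<otimes> y"] assms by (simp add: inv_solve_left m_assoc[symmetric])

text \<open>Distances between values of a cocycle depend only on the quotient of the arguments, which is why
  both the Lipschitz and the compression condition reduce to the size of the cocycle.\<close>

lemma cocycle_diff_norm: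
  assumes "x \<in> carrier G" "y \<in> carrier G"
  shows "Lp_norm p (b x - b y) = Lp_norm p (b (inv x \<otimes> y))"
  using assms by (simp add: cocycle_diff Lp_norm_eq Lp_pow_uminus iso_pow cocycle_in)

lemma cocycle_inv: "x \<in> carrier G \<Longrightarrow> \<pi> x (b (inv x)) = - b x"
  using cocycle_mult[of x "inv x"] by (simp add: cocycle_one eq_neg_iff_add_eq_0)

text \<open>The head of the list is the last step, so that induction on the list conditions on the past.\<close>

primrec walk :: "'a list \<Rightarrow> 'a" where
  "walk [] = \<one>"
| "walk (s # w) = walk w \<otimes> s"

text \<open>The martingale part of the cocycle along the walk: \<open>v\<close> stands for the mean of \<open>b\<close> over the steps,
  so each new increment is centred given the past.\<close>

primrec mart :: "L0 \<Rightarrow> 'a list \<Rightarrow> L0" where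
  "mart v [] = 0"
| "mart v (s # w) = mart v w + \<pi> (walk w) (b s - v)"

lemma walk_in: "set w \<subseteq> carrier G \<Longrightarrow> walk w \<in> carrier G"
  by (induction w) auto

lemma mart_in: "v \<in> Lp p \<Longrightarrow> set w \<subseteq> carrier G \<Longrightarrow> mart v w \<in> Lp p"
  by (induction w) (auto intro!: Lp_add Lp_diff iso_in simp: p Lp_zero walk_in cocycle_in)

lemma walk_append1: "set w \<subseteq> carrier G \<Longrightarrow> s \<in> carrier G \<Longrightarrow> walk (w @ [s]) = s \<otimes> walk w"
  by (induction w) (auto simp: walk_in m_assoc)

lemma mart_append1:
  assumes "v \<in> Lp p" "set w \<subseteq> carrier G" "s \<in> carrier G"
  shows "mart v (w @ [s]) = (b s - v) + \<pi> s (mart v w)"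
  using assms(2)
proof (induction w)
  case Nil
  then show ?case
    using assms by (simp add: iso_one iso_zero Lp_diff p cocycle_in)
next
  case (Cons a w)
  then have "b a - v \<in> Lp p" "walk w \<in> carrier G" "mart v w \<in> Lp p"
    using assms by (auto intro!: Lp_diff simp: p cocycle_in walk_in mart_in)
  with Cons show ?case
    using assms(3) by (simp add: walk_append1 iso_mult iso_add iso_in add.assoc)
qed

text \<open>The drift subtracted in \<open>mart v w\<close> is the sum of \<open>\<pi> (W) v\<close> over all proper initial pieces \<open>W\<close> of the
  walk. For the inverse walk, transported by \<open>\<pi> (walk w)\<close>, it is the sum over all nonempty initial
  pieces. The two sums differ only in their end terms, so the drifts cancel up to \<open>v - \<pi> (walk w) v\<close>,
  whereas the cocycle itself doubles because \<open>\<pi> (x) (b (inv x)) = - b x\<close>.\<close>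

lemma forward_backward:
  assumes v: "v \<in> Lp p" and w: "set w \<subseteq> carrier G"
  shows "\<pi> (walk w) (mart v (rev (map (\<lambda>s. inv s) w)))
    = mart v w - 2 *\<^sub>R b (walk w) + v - \<pi> (walk w) v"
  using w
proof (induction w)
  case Nil
  then show ?case using v by (simp add: cocycle_one iso_one Lp_zero)
next
  case (Cons s w)
  let ?w' = "rev (map (\<lambda>s. inv s) w)"
  have s: "s \<in> carrier G" and w: "set w \<subseteq> carrier G" and X: "walk w \<in> carrier G"
    and w': "set ?w' \<subseteq> carrier G"
    using Cons.prems by (auto simp: walk_in)
  have m: "mart v ?w' \<in> Lp p" using v w' by (rule mart_in)
  have "\<pi> (walk w \<otimes> s) (mart v (?w' @ [inv s]))
      = \<pi> (walk w) (\<pi> s (b (inv s)) - \<pi> s v + mart v ?w')"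
    using s X v m iso_mult[of s "inv s" "mart v ?w'"]
    by (simp add: mart_append1[OF v w'] iso_mult iso_add iso_diff Lp_add Lp_diff p
        cocycle_in iso_in iso_one)
  also have "\<dots> = - \<pi> (walk w) (b s) - \<pi> (walk w) (\<pi> s v) + \<pi> (walk w) (mart v ?w')"
    using s X v m
    by (simp add: cocycle_inv iso_add iso_diff Lp_diff Lp_uminus_iff p cocycle_in iso_in iso_uminus)
  also have "\<dots> = mart v (s # w) - 2 *\<^sub>R b (walk (s # w)) + v - \<pi> (walk (s # w)) v"
    unfolding Cons.IH[OF w]
    using s X v by (simp add: cocycle_mult iso_mult iso_diff cocycle_in algebra_simps scaleR_2)
  finally show ?case by simp
qed

text \<open>Both martingales of \<open>forward_backward\<close> have the same moments, since reversing and inverting words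
  permutes the words of a given length when the set of steps is symmetric. Iterating \<open>Lp_pow_step\<close>
  with \<open>m = n\<close> multiplies the moment by \<open>1 + C / n\<close> in each step, altogether by at most \<open>exp C\<close>.\<close>

lemma cocycle_moment_growth:
  assumes T: "finite T" "T \<noteq> {}" "T \<subseteq> carrier G" "\<And>s. s \<in> T \<Longrightarrow> inv s \<in> T"
  shows "\<exists>C. \<forall>n\<ge>1. (\<Sum>w | set w \<subseteq> T \<and> length w = n. Lp_pow p (b (walk w)))
      \<le> C * real n powr max 1 (p / 2) * real (card T) ^ n"
proof -
  define W where "W n = {w. set w \<subseteq> T \<and> length w = n}" for n
  define v where "v = (1 / real (card T)) *\<^sub>R (\<Sum>s\<in>T. b s)"
  define D where "D = (\<Sum>s\<in>T. Lp_pow p (b s - v))"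
  define r where "r = max 1 (p / 2)"
  have N: "card T > 0" using T by (simp add: card_gt_0_iff)
  have bT: "b s \<in> Lp p" if "s \<in> T" for s using that T cocycle_in by auto
  have v: "v \<in> Lp p" unfolding v_def by (intro Lp_scaleR Lp_sum p bT)
  have D: "0 \<le> D" unfolding D_def by (intro sum_nonneg) simp
  have centred: "(\<Sum>s\<in>T. b s - v) = 0"
    using N by (simp add: sum_subtractf v_def sum_constant_scaleR)
  have finW: "finite (W n)" for n
    unfolding W_def by (rule finite_lists_length_eq[OF T(1)])
  have cardW: "card (W n) = card T ^ n" for n
    unfolding W_def by (rule card_lists_length_eq[OF T(1)])
  have sumW: "(\<Sum>w\<in>W (Suc n). F w) = (\<Sum>w\<in>W n. \<Sum>s\<in>T. F (s # w))" for n and F :: "'a list \<Rightarrow> real"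
    unfolding W_def by (rule sum_lists_Suc)
  have W_in: "set w \<subseteq> carrier G" if "w \<in> W n" for w n
    using that T by (auto simp: W_def)
  obtain C where C: "0 \<le> C" and step: "\<And>m u d. 1 \<le> m \<Longrightarrow> u \<in> Lp p \<Longrightarrow>
       (\<And>s. s \<in> T \<Longrightarrow> d s \<in> Lp p) \<Longrightarrow> (\<Sum>s\<in>T. d s) = 0 \<Longrightarrow>
       (\<Sum>s\<in>T. Lp_pow p (u + d s)) \<le> (1 + C / m) * (real (card T) * Lp_pow p u)
          + C * m powr (max 1 (p / 2) - 1) * (\<Sum>s\<in>T. Lp_pow p (d s))"
    using Lp_pow_step[OF p] T(1) by metis
  have mart_bound: "(\<Sum>w\<in>W t. Lp_pow p (mart v w))
      \<le> (1 + C / m) ^ t * real t * (C * m powr (r - 1) * D) * real (card T) ^ t"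
    if m: "1 \<le> m" for m :: real and t
  proof (induction t)
    case 0
    then show ?case using p by (simp add: W_def Lp_pow_zero cong: conj_cong)
  next
    case (Suc t)
    let ?q = "1 + C / m" and ?K = "C * m powr (r - 1) * D" and ?N = "real (card T)"
    have q: "1 \<le> ?q" using C m by simp
    have K: "0 \<le> ?K" using C D by simp
    have "(\<Sum>w\<in>W (Suc t). Lp_pow p (mart v w))
        = (\<Sum>w\<in>W t. \<Sum>s\<in>T. Lp_pow p (mart v w + \<pi> (walk w) (b s - v)))"
      by (simp add: sumW)
    also have "\<dots> \<le> (\<Sum>w\<in>W t. ?q * (?N * Lp_pow p (mart v w)) + ?K)"
    proof (rule sum_mono)
      fix w assume "w \<in> W t"
      then have w: "set w \<subseteq> carrier G" and X: "walk w \<in> carrier G" using W_in walk_in by auto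
      have d: "b s - v \<in> Lp p" if "s \<in> T" for s using that bT v p by (intro Lp_diff)
      have "(\<Sum>s\<in>T. \<pi> (walk w) (b s - v)) = \<pi> (walk w) (\<Sum>s\<in>T. b s - v)"
        using X d by (intro iso_sum[symmetric]) auto
      then have "(\<Sum>s\<in>T. \<pi> (walk w) (b s - v)) = 0" using X centred by (simp add: iso_zero)
      from step[OF m mart_in[OF v w] _ this] d X
      have "(\<Sum>s\<in>T. Lp_pow p (mart v w + \<pi> (walk w) (b s - v))) \<le> ?q * (?N * Lp_pow p (mart v w))
          + C * m powr (max 1 (p / 2) - 1) * (\<Sum>s\<in>T. Lp_pow p (\<pi> (walk w) (b s - v)))"
        by (simp add: iso_in)
      also have "(\<Sum>s\<in>T. Lp_pow p (\<pi> (walk w) (b s - v))) = D"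
        unfolding D_def using d X by (intro sum.cong) (auto simp: iso_pow)
      finally show "(\<Sum>s\<in>T. Lp_pow p (mart v w + \<pi> (walk w) (b s - v)))
          \<le> ?q * (?N * Lp_pow p (mart v w)) + ?K" by (simp add: r_def)
    qed
    also have "\<dots> = ?q * ?N * (\<Sum>w\<in>W t. Lp_pow p (mart v w)) + ?N ^ t * ?K"
      by (simp add: sum.distrib sum_distrib_left cardW mult.assoc)
    also have "\<dots> \<le> ?q * ?N * (?q ^ t * real t * ?K * ?N ^ t) + (?q * ?N * (?q ^ t * ?N ^ t)) * ?K"
    proof (intro add_mono mult_left_mono mult_right_mono)
      have "?N ^ t = 1 * (1 * ?N ^ t)" by simp
      also have "\<dots> \<le> (?q * ?N) * (?q ^ t * ?N ^ t)"
      proof (intro mult_mono)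
        have "1 * 1 \<le> ?q * ?N" using q N by (intro mult_mono) auto
        then show "1 \<le> ?q * ?N" by simp
        show "1 \<le> ?q ^ t" using q by (rule one_le_power)
      qed (use q in auto)
      finally show "?N ^ t \<le> ?q * ?N * (?q ^ t * ?N ^ t)" by simp
    qed (use Suc.IH q K in auto)
    also have "\<dots> = ?q ^ Suc t * real (Suc t) * ?K * ?N ^ Suc t"
      by (simp add: algebra_simps add_divide_distrib)
    finally show ?case .
  qed
  define E where "E = exp C * (C * D)"
  have E: "0 \<le> E" using C D by (simp add: E_def)
  have mart_bound': "(\<Sum>w\<in>W n. Lp_pow p (mart v w)) \<le> E * real n powr r * real (card T) ^ n"
    if n: "1 \<le> n" for n
  proof -
    have "(1 + C / real n) ^ n \<le> exp C"
      using exp_ge_one_plus_x_over_n_power_n[of n C] C n by simp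
    then have "(1 + C / real n) ^ n * (real n * (C * real n powr (r - 1) * D) * real (card T) ^ n)
        \<le> exp C * (real n * (C * real n powr (r - 1) * D) * real (card T) ^ n)"
      using C D by (intro mult_right_mono) auto
    also have "\<dots> = E * (real n * real n powr (r - 1)) * real (card T) ^ n"
      by (simp add: E_def)
    also have "real n * real n powr (r - 1) = real n powr r"
      using n by (simp add: powr_diff)
    finally show ?thesis using mart_bound[of "real n" n] n by (simp add: mult.assoc)
  qed
  have pointwise: "Lp_pow p (b (walk w)) \<le> Lp_pow p (mart v w)
      + 2 powr p * (Lp_pow p (mart v (rev (map (\<lambda>s. inv s) w))) + 2 powr p * (2 * Lp_pow p v))"
    if w: "set w \<subseteq> carrier G" for w
  proof -
    let ?m' = "mart v (rev (map (\<lambda>s. inv s) w))"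
    have X: "walk w \<in> carrier G" using w by (rule walk_in)
    have m: "mart v w \<in> Lp p" using v w by (rule mart_in)
    have m': "?m' \<in> Lp p" using w by (intro mart_in v) auto
    have "2 *\<^sub>R b (walk w) = mart v w + (\<pi> (walk w) (- ?m') + (v + \<pi> (walk w) (- v)))"
      using forward_backward[OF v w] X m' v by (simp add: iso_uminus algebra_simps)
    moreover have "Lp_pow p (v + \<pi> (walk w) (- v)) \<le> 2 powr p * (2 * Lp_pow p v)"
      using Lp_pow_add_le[OF p v iso_in[OF X, of "- v"]] v X
      by (simp add: Lp_uminus_iff iso_pow Lp_pow_uminus)
    then have "Lp_pow p (\<pi> (walk w) (- ?m') + (v + \<pi> (walk w) (- v)))
        \<le> 2 powr p * (Lp_pow p ?m' + 2 powr p * (2 * Lp_pow p v))"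
      using Lp_pow_add_le[OF p iso_in[OF X, of "- ?m'"], of "v + \<pi> (walk w) (- v)"] v X m' p
      by (smt (verit) Lp_add Lp_pow_uminus Lp_uminus_iff iso_in iso_pow mult_left_mono powr_ge_zero)
    moreover have "Lp_pow p (mart v w + (\<pi> (walk w) (- ?m') + (v + \<pi> (walk w) (- v))))
        \<le> 2 powr p * (Lp_pow p (mart v w) + Lp_pow p (\<pi> (walk w) (- ?m') + (v + \<pi> (walk w) (- v))))"
      using v X m m' p by (intro Lp_pow_add_le Lp_add iso_in) (auto simp: Lp_uminus_iff)
    moreover have "Lp_pow p (2 *\<^sub>R b (walk w)) = 2 powr p * Lp_pow p (b (walk w))"
      using Lp_scaleR(2)[of "b (walk w)" p 2] cocycle_in[OF X] by simp
    ultimately have "2 powr p * Lp_pow p (b (walk w)) \<le> 2 powr p * (Lp_pow p (mart v w)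
        + 2 powr p * (Lp_pow p ?m' + 2 powr p * (2 * Lp_pow p v)))"
      by (smt (verit) mult_left_mono powr_ge_zero)
    then show ?thesis by simp
  qed
  have rev_sum: "(\<Sum>w\<in>W n. Lp_pow p (mart v (rev (map (\<lambda>s. inv s) w)))) = (\<Sum>w\<in>W n. Lp_pow p (mart v w))"
    for n
  proof (rule sum.reindex_bij_witness[where i = "\<lambda>w. rev (map (\<lambda>s. inv s) w)" and j = "\<lambda>w. rev (map (\<lambda>s. inv s) w)"])
    fix w assume w: "w \<in> W n"
    have "map (\<lambda>s. inv (inv s)) w = w"
      using W_in[OF w] by (intro map_idI) auto
    then show "rev (map (\<lambda>s. inv s) (rev (map (\<lambda>s. inv s) w))) = w"
      by (simp add: rev_map o_def)
    then show "rev (map (\<lambda>s. inv s) (rev (map (\<lambda>s. inv s) w))) = w" .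
    show "rev (map (\<lambda>s. inv s) w) \<in> W n" using w T(4) by (auto simp: W_def)
    then show "rev (map (\<lambda>s. inv s) w) \<in> W n" .
  qed auto
  define C' where "C' = E + 2 powr p * (E + 2 powr p * (2 * Lp_pow p v))"
  show ?thesis
  proof (intro exI[of _ C'] allI impI)
    fix n :: nat assume n: "1 \<le> n"
    let ?B = "real n powr r * real (card T) ^ n"
    have B: "real (card T) ^ n * 1 \<le> ?B"
    proof -
      have "1 \<le> real n powr r" using n by (intro ge_one_powr_ge_zero) (auto simp: r_def)
      then show ?thesis by (simp add: mult_le_cancel_right1)
    qed
    have "(\<Sum>w\<in>W n. Lp_pow p (b (walk w))) \<le> (\<Sum>w\<in>W n. Lp_pow p (mart v w)
      + 2 powr p * (Lp_pow p (mart v (rev (map (\<lambda>s. inv s) w))) + 2 powr p * (2 * Lp_pow p v)))"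
      by (intro sum_mono pointwise) (rule W_in)
    also have "\<dots> = (\<Sum>w\<in>W n. Lp_pow p (mart v w)) + 2 powr p * ((\<Sum>w\<in>W n. Lp_pow p (mart v w))
        + 2 powr p * (2 * Lp_pow p v) * real (card T) ^ n)"
      by (simp add: sum.distrib sum_distrib_left[symmetric] rev_sum cardW)
    also have "\<dots> \<le> E * ?B + 2 powr p * (E * ?B + 2 powr p * (2 * Lp_pow p v) * ?B)"
      using mart_bound'[OF n] B by (intro add_mono mult_left_mono) (auto simp: mult.assoc)
    also have "\<dots> = C' * ?B" by (simp add: C'_def algebra_simps)
    finally show "(\<Sum>w | set w \<subseteq> T \<and> length w = n. Lp_pow p (b (walk w)))
      \<le> C' * real n powr max 1 (p / 2) * real (card T) ^ n"
      by (simp add: W_def r_def mult.assoc)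
  qed
qed

end

section \<open>Word lengths\<close>

lemma (in group) foldr_mult_closed:
  "set ws \<subseteq> carrier G \<Longrightarrow> foldr (\<otimes>) ws \<one> \<in> carrier G"
  by (induction ws) auto

lemma (in group) foldr_mult_append:
  "set us \<subseteq> carrier G \<Longrightarrow> set ws \<subseteq> carrier G \<Longrightarrow>
    foldr (\<otimes>) (us @ ws) \<one> = foldr (\<otimes>) us \<one> \<otimes> foldr (\<otimes>) ws \<one>"
  by (induction us) (auto simp: m_assoc foldr_mult_closed simp del: foldr_append)

lemma (in group) word_length_le:
  "set ws \<subseteq> S \<Longrightarrow> foldr (\<otimes>) ws \<one> = g \<Longrightarrow> word_length G S g \<le> length ws"
  unfolding word_length_def by (rule Least_le) auto

lemma (in group) word_length_witness:
  assumes S: "finite_symmetric_generating G S" and g: "g \<in> carrier G"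
  obtains ws where "set ws \<subseteq> S" "length ws = word_length G S g" "foldr (\<otimes>) ws \<one> = g"
proof -
  have sub: "S \<subseteq> carrier G" using S by (simp add: finite_symmetric_generating_def)
  have "\<exists>ws. set ws \<subseteq> S \<and> foldr (\<otimes>) ws \<one> = g" if "g \<in> generate G S"
    using that
  proof (induction rule: generate.induct)
    case one
    then show ?case by (intro exI[of _ "[]"]) simp
  next
    case (incl h)
    then show ?case using sub by (intro exI[of _ "[h]"]) auto
  next
    case (inv h)
    then have "inv h \<in> S" using S by (simp add: finite_symmetric_generating_def)
    then show ?case using sub by (intro exI[of _ "[inv h]"]) auto
  next
    case (eng h1 h2)
    then obtain us ws where "set us \<subseteq> S" "foldr (\<otimes>) us \<one> = h1" "set ws \<subseteq> S" "foldr (\<otimes>) ws \<one> = h2"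
      by blast
    then show ?case using sub foldr_mult_append[of us ws]
      by (intro exI[of _ "us @ ws"]) auto
  qed
  then have "\<exists>n ws. set ws \<subseteq> S \<and> length ws = n \<and> foldr (\<otimes>) ws \<one> = g"
    using S g by (auto simp: finite_symmetric_generating_def)
  from LeastI_ex[OF this] show thesis
    using that unfolding word_length_def by blast
qed

lemma (in group) word_length_mult_le:
  assumes S: "finite_symmetric_generating G S" and g: "g \<in> carrier G" "h \<in> carrier G"
  shows "word_length G S (g \<otimes> h) \<le> word_length G S g + word_length G S h"
proof -
  obtain us where us: "set us \<subseteq> S" "length us = word_length G S g" "foldr (\<otimes>) us \<one> = g"
    using word_length_witness[OF S g(1)] .
  obtain ws where ws: "set ws \<subseteq> S" "length ws = word_length G S h" "foldr (\<otimes>) ws \<one> = h"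
    using word_length_witness[OF S g(2)] .
  have "S \<subseteq> carrier G" using S by (simp add: finite_symmetric_generating_def)
  then have "foldr (\<otimes>) (us @ ws) \<one> = g \<otimes> h"
    using foldr_mult_append[of us ws] us ws by auto
  from word_length_le[OF _ this] us ws show ?thesis by simp
qed

section \<open>The free group on two generators\<close>

lemma F2_carrier: "carrier F2 = {w. reduced_word w}"
  by (simp add: F2_def free_group_def)

lemma F2_mult: "u \<otimes>\<^bsub>F2\<^esub> v = foldr push_letter u v"
  by (simp add: F2_def free_group_def)

lemma F2_one: "\<one>\<^bsub>F2\<^esub> = []"
  by (simp add: F2_def free_group_def)

interpretation F2: group F2
  unfolding F2_def by (rule group_free_group)

lemma length_push_letter: "length (push_letter s w) \<le> Suc (length w)"
  by (cases w) auto

lemma length_F2_mult: "length (u \<otimes>\<^bsub>F2\<^esub> v) \<le> length u + length v"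
  unfolding F2_mult
proof (induction u)
  case (Cons s u)
  then show ?case using length_push_letter[of s "foldr push_letter u v"] by simp
qed simp

lemma letter_times: "reduced_word (s # w) \<Longrightarrow> [s] \<otimes>\<^bsub>F2\<^esub> w = s # w"
  by (cases w) (auto simp: F2_mult reduced_Cons)

lemma reduced_snoc:
  "reduced_word (w @ [s]) \<longleftrightarrow> reduced_word w \<and> (w = [] \<or> last w \<noteq> inv_letter s)"
  by (auto simp: reduced_word_def successively_append_iff inv_letter_eq_iff)

lemma times_letter:
  assumes w: "reduced_word w"
  shows "w \<otimes>\<^bsub>F2\<^esub> [s] = (if w \<noteq> [] \<and> last w = inv_letter s then butlast w else w @ [s])"
proof (cases "w \<noteq> [] \<and> last w = inv_letter s")
  case True
  then obtain u where u: "w = u @ [inv_letter s]" by (metis append_butlast_last_id)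
  then have "reduced_word u" using w by (simp add: reduced_snoc)
  then show ?thesis using u by (simp add: F2_mult foldr_push_letter_Nil)
next
  case False
  then have "reduced_word (w @ [s])" using w by (auto simp: reduced_snoc)
  from foldr_push_letter_Nil[OF this] False show ?thesis by (auto simp: F2_mult)
qed

text \<open>Among the four letters only one cancels, so the random walk moves away from the identity at
  speed at least one half.\<close>

lemma sum_length_times_letter:
  assumes w: "reduced_word w"
  shows "(\<Sum>s\<in>UNIV. real (length (w \<otimes>\<^bsub>F2\<^esub> [s]))) \<ge> 4 * real (length w) + 2"
proof (cases "w = []")
  case True
  have "card (UNIV :: (bool \<times> bool) set) = 4" by simp
  with True show ?thesis using times_letter[OF w] by simp
next
  case False
  define a where "a = inv_letter (last w)"
  have "real (length (w \<otimes>\<^bsub>F2\<^esub> [s])) = real (length w) + 1 - (if s = a then 2 else 0)" for s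
    using False times_letter[OF w, of s] by (auto simp: a_def inv_letter_eq_iff of_nat_diff Suc_le_eq)
  then show ?thesis by (simp add: sum_subtractf sum.delta)
qed

lemma length_le_word_length:
  assumes S: "finite_symmetric_generating F2 S"
  obtains K :: nat where "0 < K" "\<And>w. w \<in> carrier F2 \<Longrightarrow> length w \<le> K * word_length F2 S w"
proof (rule that[of "Suc (\<Sum>s\<in>S. length s)"])
  fix w assume "w \<in> carrier F2"
  then obtain ws where ws: "set ws \<subseteq> S" "length ws = word_length F2 S w" "foldr (\<otimes>\<^bsub>F2\<^esub>) ws \<one>\<^bsub>F2\<^esub> = w"
    using F2.word_length_witness[OF S] by metis
  have fin: "finite S" using S by (simp add: finite_symmetric_generating_def)
  have "length (foldr (\<otimes>\<^bsub>F2\<^esub>) ws \<one>\<^bsub>F2\<^esub>) \<le> Suc (\<Sum>s\<in>S. length s) * length ws"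
    using ws(1)
  proof (induction ws)
    case (Cons s ws)
    have "length s \<le> (\<Sum>s\<in>S. length s)"
      using Cons.prems fin by (intro member_le_sum) auto
    then show ?case
      using Cons length_F2_mult[of s "foldr (\<otimes>\<^bsub>F2\<^esub>) ws \<one>\<^bsub>F2\<^esub>"] by simp
  qed (simp add: F2_one)
  then show "length w \<le> Suc (\<Sum>s\<in>S. length s) * word_length F2 S w" using ws by simp
qed simp

lemma word_length_le_length:
  assumes S: "finite_symmetric_generating F2 S"
  obtains K :: nat where "0 < K" "\<And>w. w \<in> carrier F2 \<Longrightarrow> word_length F2 S w \<le> K * length w"
proof (rule that[of "Suc (\<Sum>l\<in>UNIV. word_length F2 S [l])"])
  fix w assume "w \<in> carrier F2"
  then have "reduced_word w" by (simp add: F2_carrier)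
  then show "word_length F2 S w \<le> Suc (\<Sum>l\<in>UNIV. word_length F2 S [l]) * length w"
  proof (induction w)
    case Nil
    have "word_length F2 S \<one>\<^bsub>F2\<^esub> \<le> length ([] :: (bool \<times> bool) list list)"
      by (rule F2.word_length_le) auto
    then show ?case by (simp add: F2_one)
  next
    case (Cons s w)
    have "word_length F2 S [s] \<le> (\<Sum>l\<in>UNIV. word_length F2 S [l])"
      by (rule member_le_sum) auto
    moreover have "word_length F2 S ([s] \<otimes>\<^bsub>F2\<^esub> w) \<le> word_length F2 S [s] + word_length F2 S w"
      using Cons.prems by (intro F2.word_length_mult_le S) (auto simp: F2_carrier reduced_Cons)
    ultimately show ?case
      using Cons letter_times[OF Cons.prems] by (simp add: reduced_Cons)
  qed
qed simp

section \<open>The upper bound\<close>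

text \<open>A substitute for Jensen's inequality: summed over a sample whose mean is at least \<open>2 * a\<close>, it bounds
  the mean of the \<open>q\<close>-th powers from below by \<open>a powr q\<close>.\<close>

lemma powr_ge_linear:
  fixes q a x :: real
  assumes "1 \<le> q" "0 < a" "0 \<le> x"
  shows "a powr (q - 1) * (x - a) \<le> x powr q"
proof (cases "x \<le> a")
  case True
  then show ?thesis
    by (smt (verit) mult_nonneg_nonpos powr_ge_zero)
next
  case False
  have "a powr (q - 1) * (x - a) \<le> x powr (q - 1) * x"
    using False assms by (intro mult_mono powr_mono2) auto
  also have "\<dots> = x powr q" using False assms by (simp add: powr_diff)
  finally show ?thesis .
qed

text \<open>Speed against moments: the walk is at mean distance at least \<open>n / 2\<close>, so with \<open>\<beta> = \<alpha> * p\<close> the \<open>p\<close>-th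
  moment of the cocycle is at least of order \<open>n powr \<beta>\<close>, while \<open>cocycle_moment_growth\<close> bounds it by
  \<open>n powr max 1 (p / 2)\<close>.\<close>

lemma compression_exponent_le:
  assumes p: "1 \<le> p" and S: "finite_symmetric_generating F2 S"
    and \<psi>: "equivariant_Lp p F2 \<psi>" and c: "c > 0"
    and lower: "\<And>x y. x \<in> carrier F2 \<Longrightarrow> y \<in> carrier F2 \<Longrightarrow> x \<noteq> y \<Longrightarrow>
      c * real (word_dist F2 S x y) powr \<alpha> \<le> Lp_norm p (\<psi> x - \<psi> y)"
    and \<alpha>: "0 \<le> \<alpha>"
  shows "\<alpha> \<le> max (1 / 2) (1 / p)"
proof (rule ccontr)
  obtain \<pi> f v where hom: "\<pi> \<in> hom F2 (Isom_Lp p)" and f: "is_cocycle p F2 \<pi> f"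
    and v: "v \<in> Lp p" and \<psi>_eq: "\<And>x. x \<in> carrier F2 \<Longrightarrow> \<psi> x = \<pi> x v + f x"
    using \<psi> unfolding equivariant_Lp_def by blast
  interpret f: Lp_cocycle F2 p \<pi> f
    by unfold_locales (use p hom f in auto)
  \<comment> \<open>Adding a coboundary moves the base point to \<open>0\<close> without changing differences.\<close>
  define b where "b x = f x + (\<pi> x v - v)" for x
  have b: "is_cocycle p F2 \<pi> b"
    unfolding is_cocycle_def b_def using v p
    by (auto simp: f.cocycle_mult f.iso_mult f.iso_add f.iso_diff f.iso_in f.cocycle_in
        Lp_add Lp_diff)
  interpret b: Lp_cocycle F2 p \<pi> b
    by unfold_locales (use p hom b in auto)
  define r where "r = max 1 (p / 2)"
  define \<beta> where "\<beta> = \<alpha> * p"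
  assume "\<not> \<alpha> \<le> max (1 / 2) (1 / p)"
  then have "1 / 2 < \<alpha>" "1 / p < \<alpha>" by auto
  then have \<beta>: "r < \<beta>" using p by (simp add: r_def \<beta>_def pos_divide_less_eq mult.commute)
  have \<beta>1: "1 \<le> \<beta>" using \<beta> by (simp add: r_def)
  obtain K where K: "0 < K" "\<And>w. w \<in> carrier F2 \<Longrightarrow> length w \<le> K * word_length F2 S w"
    using length_le_word_length[OF S] by blast
  define k where "k = c / real K powr \<alpha>"
  have k: "0 < k" using c K by (simp add: k_def)
  define c1 where "c1 = k powr p"
  have c1: "0 < c1" using k by (simp add: c1_def)
  have b_lower: "c1 * real (length w) powr \<beta> \<le> Lp_pow p (b w)" if w: "w \<in> carrier F2" for w
  proof (cases "w = []")
    case False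
    have "k * real (length w) powr \<alpha> = c * (real (length w) / real K) powr \<alpha>"
      using K by (simp add: k_def powr_divide)
    also have "real (length w) / real K \<le> real (word_length F2 S w)"
      using K(1) of_nat_mono[OF K(2)[OF w], where ?'a = real] by (simp add: field_simps)
    then have "c * (real (length w) / real K) powr \<alpha> \<le> c * real (word_length F2 S w) powr \<alpha>"
      using c \<alpha> by (intro mult_left_mono powr_mono2) auto
    also have "\<dots> = c * real (word_dist F2 S \<one>\<^bsub>F2\<^esub> w) powr \<alpha>"
      using w by (simp add: word_dist_def)
    also have "\<dots> \<le> Lp_norm p (\<psi> \<one>\<^bsub>F2\<^esub> - \<psi> w)"
      using False w by (intro lower) (auto simp: F2_one F2_carrier)
    also have "\<psi> \<one>\<^bsub>F2\<^esub> - \<psi> w = b \<one>\<^bsub>F2\<^esub> - b w"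
      using w by (simp add: \<psi>_eq b_def)
    also have "Lp_norm p (b \<one>\<^bsub>F2\<^esub> - b w) = Lp_norm p (b w)"
      using w by (simp add: b.cocycle_diff_norm)
    finally have "(k * real (length w) powr \<alpha>) powr p \<le> Lp_norm p (b w) powr p"
      using k p by (intro powr_mono2) auto
    then show ?thesis
      using p k by (simp add: Lp_pow_eq powr_mult powr_powr c1_def \<beta>_def)
  qed (use \<beta>1 in simp)
  define T where "T = range (\<lambda>l :: bool \<times> bool. [l])"
  have T: "finite T" "T \<noteq> {}" "T \<subseteq> carrier F2" "\<And>s. s \<in> T \<Longrightarrow> inv\<^bsub>F2\<^esub> s \<in> T"
    using finite_symmetric_generating_F2 by (auto simp: finite_symmetric_generating_def T_def)
  have inj: "inj (\<lambda>l :: bool \<times> bool. [l])" by (simp add: inj_def)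
  have cT: "card T = 4" unfolding T_def card_image[OF inj] by simp
  define W where "W n = {w. set w \<subseteq> T \<and> length w = n}" for n
  have cW: "card (W n) = 4 ^ n" for n
    unfolding W_def by (simp add: card_lists_length_eq[OF T(1)] cT)
  have walk_in: "b.walk w \<in> carrier F2" if "w \<in> W n" for w n
    using that T by (intro b.walk_in) (auto simp: W_def)
  have speed: "real n / 2 * 4 ^ n \<le> (\<Sum>w\<in>W n. real (length (b.walk w)))" for n
  proof (induction n)
    case (Suc n)
    have "real (Suc n) / 2 * 4 ^ Suc n = 4 * (real n / 2 * 4 ^ n) + 2 * real (card (W n))"
      by (simp add: cW algebra_simps)
    also have "\<dots> \<le> 4 * (\<Sum>w\<in>W n. real (length (b.walk w))) + 2 * real (card (W n))"
      using Suc.IH by simp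
    also have "\<dots> = (\<Sum>w\<in>W n. 4 * real (length (b.walk w)) + 2)"
      by (simp add: sum.distrib sum_distrib_left)
    also have "\<dots> \<le> (\<Sum>w\<in>W n. \<Sum>s\<in>UNIV. real (length (b.walk w \<otimes>\<^bsub>F2\<^esub> [s])))"
      using walk_in by (intro sum_mono sum_length_times_letter) (auto simp: F2_carrier)
    also have "\<dots> = (\<Sum>w\<in>W n. \<Sum>s\<in>T. real (length (b.walk (s # w))))"
      unfolding T_def sum.reindex[OF inj] by (simp add: o_def)
    also have "\<dots> = (\<Sum>w\<in>W (Suc n). real (length (b.walk w)))"
      unfolding W_def by (rule sum_lists_Suc[symmetric])
    finally show ?case .
  qed (simp add: sum_nonneg)
  obtain C where C: "\<And>n. 1 \<le> n \<Longrightarrow>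
    (\<Sum>w\<in>W n. Lp_pow p (b (b.walk w))) \<le> C * real n powr r * real (card T) ^ n"
    using b.cocycle_moment_growth[OF T] unfolding r_def W_def by blast
  have bound: "real n powr (\<beta> - r) \<le> C * 4 powr \<beta> / c1" if n: "1 \<le> n" for n :: nat
  proof -
    \<comment> \<open>Half of the lower bound for the mean distance.\<close>
    let ?a = "real n / 4"
    have a: "0 < ?a" using n by simp
    have "c1 * ?a powr \<beta> * 4 ^ n = c1 * (?a powr (\<beta> - 1) * (real n / 2 * 4 ^ n - ?a * real (card (W n))))"
      using a by (simp add: cW powr_diff algebra_simps)
    also have "\<dots> \<le> c1 * (?a powr (\<beta> - 1) * ((\<Sum>w\<in>W n. real (length (b.walk w))) - ?a * real (card (W n))))"
      using c1 speed[of n] by (intro mult_left_mono diff_right_mono) auto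
    also have "\<dots> = (\<Sum>w\<in>W n. c1 * (?a powr (\<beta> - 1) * (real (length (b.walk w)) - ?a)))"
      by (simp add: sum_distrib_left[symmetric] sum_subtractf mult.commute)
    also have "\<dots> \<le> (\<Sum>w\<in>W n. c1 * real (length (b.walk w)) powr \<beta>)"
      using c1 a \<beta>1 by (intro sum_mono mult_left_mono powr_ge_linear) auto
    also have "\<dots> \<le> (\<Sum>w\<in>W n. Lp_pow p (b (b.walk w)))"
      by (intro sum_mono b_lower) (rule walk_in)
    also have "\<dots> \<le> C * real n powr r * 4 ^ n" using C[OF n] cT by simp
    finally have "c1 * ?a powr \<beta> \<le> C * real n powr r" by simp
    then show ?thesis using c1 n by (simp add: powr_divide powr_diff field_simps)
  qed
  define M where "M = max 1 (C * 4 powr \<beta> / c1)"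
  have M: "1 \<le> M" "C * 4 powr \<beta> / c1 \<le> M"
    unfolding M_def by (rule max.cobounded1, rule max.cobounded2)
  obtain n :: nat where n: "M powr (1 / (\<beta> - r)) < real n"
    using reals_Archimedean2 by blast
  have "1 \<le> M powr (1 / (\<beta> - r))"
    using \<beta> M(1) by (intro ge_one_powr_ge_zero) auto
  then have n1: "1 \<le> n" using n by linarith
  have "M = (M powr (1 / (\<beta> - r))) powr (\<beta> - r)"
    using \<beta> M(1) by (simp add: powr_powr)
  also have "\<dots> < real n powr (\<beta> - r)"
    using n \<beta> by (intro powr_less_mono2) auto
  also have "\<dots> \<le> M" using bound[OF n1] M(2) by (rule order_trans)
  finally show False by simp
qed

section \<open>Permuting the dyadic shells of the unit interval\<close>

definition shell :: "nat \<Rightarrow> real set" where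
  "shell n = {(1 / 2) ^ Suc n <.. (1 / 2) ^ n}"

definition shell_index :: "real \<Rightarrow> nat" where
  "shell_index t = (LEAST n. (1 / 2) ^ Suc n < t)"

lemma shell_index_eq:
  assumes "t \<in> shell n"
  shows "shell_index t = n"
  unfolding shell_index_def
proof (rule Least_equality)
  show "(1 / 2) ^ Suc n < t" using assms by (simp add: shell_def)
  fix m assume "(1 / 2) ^ Suc m < t"
  then have "(1 / 2 :: real) ^ Suc m < (1 / 2) ^ n" using assms by (simp add: shell_def)
  then have "n < Suc m" by (subst (asm) power_strict_decreasing_iff) auto
  then show "n \<le> m" by simp
qed

lemma in_shell_index:
  assumes "0 < t" "t \<le> 1"
  shows "t \<in> shell (shell_index t)"
proof -
  obtain n where n: "(1 / 2) ^ n < t" using real_arch_pow_inv[of t "1 / 2"] assms by auto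
  then have "(1 / 2) ^ Suc n < t"
    by (rule le_less_trans[rotated]) (simp add: power_decreasing)
  then have 1: "(1 / 2) ^ Suc (shell_index t) < t"
    unfolding shell_index_def by (rule LeastI)
  have "t \<le> (1 / 2) ^ shell_index t"
  proof (cases "shell_index t")
    case (Suc k)
    then have "\<not> (1 / 2) ^ Suc k < t"
      unfolding shell_index_def by (intro not_less_Least) simp
    then show ?thesis using Suc by simp
  qed (use assms in simp)
  with 1 show ?thesis by (simp add: shell_def)
qed

lemma shell_disjoint: "disjoint_family shell"
  unfolding disjoint_family_on_def using shell_index_eq by blast

lemma shell_subset: "t \<in> shell n \<Longrightarrow> 0 < t \<and> t \<le> 1"
proof -
  assume t: "t \<in> shell n"
  have "(0 :: real) < (1 / 2) ^ Suc n" by simp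
  moreover have "(1 / 2 :: real) ^ n \<le> 1" by (rule power_le_one) auto
  ultimately show ?thesis using t by (auto simp: shell_def)
qed

lemma UN_shell: "(\<Union>n. shell n) = {0<..1}"
proof (intro equalityI subsetI)
  fix t :: real assume "t \<in> {0<..1}"
  then have "t \<in> shell (shell_index t)" by (intro in_shell_index) auto
  then show "t \<in> (\<Union>n. shell n)" by blast
qed (use shell_subset in auto)

lemma shell_subset': "shell n \<subseteq> {0..1}"
  using shell_subset by (intro subsetI) (auto intro: less_imp_le)

lemma shell_sets [measurable]: "shell n \<in> sets unit_leb"
  using shell_subset'[of n] by (subst sets_restrict_space_iff) (auto simp: shell_def)

lemma emeasure_shell: "emeasure unit_leb (shell n) = ennreal ((1 / 2) ^ Suc n)"
proof -
  have "emeasure unit_leb (shell n) = emeasure lebesgue (shell n)"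
    using shell_subset' by (intro emeasure_restrict_space) auto
  also have "\<dots> = ennreal ((1 / 2) ^ Suc n)" by (simp add: shell_def)
  finally show ?thesis .
qed

lemma AE_unit_pos: "AE t in unit_leb. 0 < t \<and> t \<le> 1"
proof -
  have "{0::real} \<in> null_sets lebesgue" by simp
  then have "AE t in lebesgue. t \<notin> {0::real}" by (rule AE_not_in)
  then have "AE t in lebesgue. t \<in> {0..1} \<longrightarrow> 0 < t \<and> t \<le> (1 :: real)"
    by eventually_elim auto
  then show ?thesis by (simp add: AE_restrict_space_iff)
qed

lemma nn_integral_shells:
  fixes g :: "real \<Rightarrow> ennreal"
  assumes [measurable]: "g \<in> borel_measurable unit_leb"
  shows "(\<integral>\<^sup>+t. g t \<partial>unit_leb) = (suminf (\<lambda>n. \<integral>\<^sup>+t. g t * indicator (shell n) t \<partial>unit_leb))"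
proof -
  have "(\<integral>\<^sup>+t. g t \<partial>unit_leb) = (\<integral>\<^sup>+t. g t * indicator (\<Union>n. shell n) t \<partial>unit_leb)"
    by (rule nn_integral_cong_AE) (use AE_unit_pos in \<open>eventually_elim, simp add: UN_shell\<close>)
  also have "\<dots> = (suminf (\<lambda>n. \<integral>\<^sup>+t. g t * indicator (shell n) t \<partial>unit_leb))"
    by (rule nn_integral_disjoint_family) (auto intro: shell_disjoint)
  finally show ?thesis .
qed

text \<open>The shells and the point \<open>0\<close> form a countable measurable partition of the unit interval.\<close>

lemma measurable_shellwise:
  assumes "\<And>n. \<exists>h\<in>measurable unit_leb N. \<forall>t\<in>shell n. f t = h t" and "f 0 \<in> space N"
  shows "f \<in> measurable unit_leb N"
proof (rule measurable_piecewise_restrict2)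
  let ?A = "\<lambda>n. case n of 0 \<Rightarrow> {0} | Suc m \<Rightarrow> shell m"
  show "?A n \<in> sets unit_leb" for n
  proof (cases n)
    case 0
    then show ?thesis by (simp add: sets_restrict_space_iff)
  qed (simp add: shell_sets)
  show "space unit_leb = (\<Union>n. ?A n)"
  proof (intro equalityI subsetI)
    fix t :: real assume "t \<in> space unit_leb"
    then consider "t = 0" | "0 < t" "t \<le> 1" by force
    then show "t \<in> (\<Union>n. ?A n)"
    proof cases
      case 1
      then show ?thesis by (intro UN_I[of 0]) auto
    next
      case 2
      then show ?thesis by (intro UN_I[of "Suc (shell_index t)"]) (auto intro: in_shell_index)
    qed
  next
    fix t assume "t \<in> (\<Union>n. ?A n)"
    then obtain n where "t \<in> ?A n" by blast
    then show "t \<in> space unit_leb" by (cases n) (auto dest: shell_subset)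
  qed
  show "\<exists>h\<in>measurable unit_leb N. \<forall>t\<in>?A n. f t = h t" for n
  proof (cases n)
    case 0
    then show ?thesis using assms(2) by (intro bexI[of _ "\<lambda>_. f 0"]) auto
  qed (use assms(1) in auto)
qed

lemma measurable_shell_index [measurable]: "shell_index \<in> measurable unit_leb (count_space UNIV)"
proof (rule measurable_shellwise)
  fix n show "\<exists>h\<in>measurable unit_leb (count_space UNIV). \<forall>t\<in>shell n. shell_index t = h t"
    by (intro bexI[of _ "\<lambda>_. n"]) (auto simp: shell_index_eq)
qed simp

definition shell_scale :: "(nat \<Rightarrow> nat) \<Rightarrow> real \<Rightarrow> real" where
  "shell_scale \<tau> t = 2 ^ shell_index t / 2 ^ \<tau> (shell_index t)"

lemma shell_scale_pos [simp]: "0 < shell_scale \<tau> t"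
  by (simp add: shell_scale_def)

lemma shell_scale_measurable [measurable]: "shell_scale \<tau> \<in> borel_measurable unit_leb"
  unfolding shell_scale_def[abs_def]
  by (rule measurable_compose[OF measurable_shell_index]) simp

lemma times_in_shell:
  "2 ^ n / 2 ^ m * t \<in> shell m \<longleftrightarrow> t \<in> shell n"
  by (auto simp: shell_def power_one_over field_simps)

definition shell_map :: "(nat \<Rightarrow> nat) \<Rightarrow> real \<Rightarrow> real" where
  "shell_map \<tau> t = shell_scale \<tau> t * t"

lemma shell_map_eq: "t \<in> shell n \<Longrightarrow> shell_map \<tau> t = 2 ^ n / 2 ^ \<tau> n * t"
  by (simp add: shell_map_def shell_scale_def shell_index_eq)

lemma shell_map_in: "t \<in> shell n \<Longrightarrow> shell_map \<tau> t \<in> shell (\<tau> n)"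
  using times_in_shell[of n "\<tau> n" t] by (simp add: shell_map_eq)

lemma shell_index_map: "0 < t \<Longrightarrow> t \<le> 1 \<Longrightarrow> shell_index (shell_map \<tau> t) = \<tau> (shell_index t)"
  using in_shell_index shell_map_in shell_index_eq by blast

lemma shell_map_measurable [measurable]: "shell_map \<tau> \<in> measurable unit_leb unit_leb"
proof (rule measurable_restrict_space2)
  show "shell_map \<tau> \<in> space unit_leb \<rightarrow> {0..1}"
  proof
    fix t :: real assume "t \<in> space unit_leb"
    then consider "t = 0" | "0 < t" "t \<le> 1" by force
    then show "shell_map \<tau> t \<in> {0..1}"
    proof cases
      case 2
      from shell_subset[OF shell_map_in[OF in_shell_index[OF this]]] show ?thesis
        by (simp add: less_imp_le)
    qed (simp add: shell_map_def)
  qed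
  show "shell_map \<tau> \<in> measurable unit_leb lebesgue"
  proof (rule measurable_shellwise)
    fix n
    have "(*\<^sub>R) (2 ^ n / 2 ^ \<tau> n :: real) \<in> measurable unit_leb lebesgue"
      by (rule measurable_restrict_space1[OF lebesgue_measurable_scaling])
    then show "\<exists>h\<in>measurable unit_leb lebesgue. \<forall>t\<in>shell n. shell_map \<tau> t = h t"
      by (rule rev_bexI) (simp add: shell_map_eq)
  qed simp
qed

text \<open>On shell \<open>n\<close> the map is a homothety onto shell \<open>\<tau> n\<close>, and its ratio is the Jacobian; a
  permutation of the shells only rearranges the sum of the integrals over them.\<close>

lemma nn_integral_shell_map:
  fixes g :: "real \<Rightarrow> ennreal"
  assumes \<tau>: "bij \<tau>" and g [measurable]: "g \<in> borel_measurable unit_leb"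
  shows "(\<integral>\<^sup>+t. ennreal (shell_scale \<tau> t) * g (shell_map \<tau> t) \<partial>unit_leb) = (\<integral>\<^sup>+t. g t \<partial>unit_leb)"
proof -
  define G where "G n = (\<integral>\<^sup>+t. g t * indicator (shell n) t \<partial>unit_leb)" for n
  have *: "(\<integral>\<^sup>+t. f t * indicator (shell n) t \<partial>unit_leb)
      = (\<integral>\<^sup>+t. f t * indicator (shell n) t \<partial>lebesgue)" for f :: "real \<Rightarrow> ennreal" and n
  proof -
    have "f t * indicator (shell n) t * indicator {0..1} t = f t * indicator (shell n) t" for t
      using shell_subset[of t n] by (auto split: split_indicator)
    then show ?thesis by (subst nn_integral_restrict_space) auto
  qed
  have "(\<integral>\<^sup>+t. ennreal (shell_scale \<tau> t) * g (shell_map \<tau> t) * indicator (shell n) t \<partial>unit_leb)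
      = G (\<tau> n)" for n
  proof -
    let ?k = "2 ^ n / 2 ^ \<tau> n :: real"
    have [measurable]: "(\<lambda>t. g t * indicator (shell (\<tau> n)) t) \<in> borel_measurable lebesgue"
    proof -
      have "(\<lambda>t. g t * indicator (shell (\<tau> n)) t) \<in> borel_measurable unit_leb" by measurable
      then have "(\<lambda>t. g t * indicator (shell (\<tau> n)) t * indicator {0..1} t) \<in> borel_measurable lebesgue"
        by (subst (asm) borel_measurable_restrict_space_iff_ennreal) auto
      also have "(\<lambda>t. g t * indicator (shell (\<tau> n)) t * indicator {0..1} t)
          = (\<lambda>t. g t * indicator (shell (\<tau> n)) t)"
        using shell_subset[of _ "\<tau> n"] by (force simp: fun_eq_iff split: split_indicator)
      finally show ?thesis .
    qed
    have "G (\<tau> n) = (\<integral>\<^sup>+t. g t * indicator (shell (\<tau> n)) t \<partial>lebesgue)"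
      unfolding G_def by (rule *)
    also have "\<dots> = ennreal ?k * (\<integral>\<^sup>+t. g (?k * t) * indicator (shell (\<tau> n)) (?k * t) \<partial>lebesgue)"
      using nn_integral_real_affine_lebesgue[of "\<lambda>t. g t * indicator (shell (\<tau> n)) t" ?k 0] by simp
    also have "\<dots> = (\<integral>\<^sup>+t. ennreal ?k * (g (?k * t) * indicator (shell (\<tau> n)) (?k * t)) \<partial>lebesgue)"
    proof (rule nn_integral_cmult[symmetric])
      have "(*) ?k = (*\<^sub>R) ?k" by (simp add: fun_eq_iff)
      then have "(\<lambda>t. ?k * t) \<in> measurable lebesgue lebesgue"
        using lebesgue_measurable_scaling[of ?k, where ?'a = real] by (simp only:)
      from measurable_compose[OF this, of "\<lambda>t. g t * indicator (shell (\<tau> n)) t"]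
      show "(\<lambda>t. g (?k * t) * indicator (shell (\<tau> n)) (?k * t)) \<in> borel_measurable lebesgue" by simp
    qed
    also have "\<dots> = (\<integral>\<^sup>+t. ennreal (shell_scale \<tau> t) * g (shell_map \<tau> t) * indicator (shell n) t \<partial>lebesgue)"
    proof (rule nn_integral_cong)
      fix t
      have "indicator (shell (\<tau> n)) (?k * t) = (indicator (shell n) t :: ennreal)"
        using times_in_shell[of n "\<tau> n" t] by (simp add: indicator_def)
      then show "ennreal ?k * (g (?k * t) * indicator (shell (\<tau> n)) (?k * t))
          = ennreal (shell_scale \<tau> t) * g (shell_map \<tau> t) * indicator (shell n) t"
        by (auto simp: shell_map_eq shell_scale_def shell_index_eq split: split_indicator)
    qed
    finally show ?thesis by (simp add: *)
  qed
  then have "(\<integral>\<^sup>+t. ennreal (shell_scale \<tau> t) * g (shell_map \<tau> t) \<partial>unit_leb) = (suminf (\<lambda>n. G (\<tau> n)))"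
    by (subst nn_integral_shells) (auto intro!: measurable_compose[OF shell_map_measurable])
  also have "\<dots> = (\<integral>\<^sup>+n. G (\<tau> n) \<partial>count_space UNIV)"
    by (simp add: nn_integral_count_space_nat)
  also have "\<dots> = (\<integral>\<^sup>+n. G n \<partial>count_space UNIV)"
    using nn_integral_bij_count_space[of \<tau> UNIV UNIV G] \<tau> by simp
  also have "\<dots> = (\<integral>\<^sup>+t. g t \<partial>unit_leb)"
    by (simp add: nn_integral_count_space_nat G_def nn_integral_shells[OF g])
  finally show ?thesis .
qed

text \<open>Preimages of null sets are null, so composition with \<open>shell_map \<tau>\<close> respects equality almost
  everywhere.\<close>

lemma AE_shell_map:
  assumes \<tau>: "bij \<tau>" and P: "AE t in unit_leb. P t"
  shows "AE t in unit_leb. P (shell_map \<tau> t)"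
proof -
  obtain N where N: "{t \<in> space unit_leb. \<not> P t} \<subseteq> N" "N \<in> null_sets unit_leb"
    using P by (auto simp: eventually_ae_filter)
  have [measurable]: "N \<in> sets unit_leb" using N by auto
  have "(\<integral>\<^sup>+t. ennreal (shell_scale \<tau> t) * indicator N (shell_map \<tau> t) \<partial>unit_leb)
      = (\<integral>\<^sup>+t. indicator N t \<partial>unit_leb)"
    by (rule nn_integral_shell_map[OF \<tau>]) simp
  also have "\<dots> = 0" using N by (simp add: null_setsD1)
  finally have "AE t in unit_leb. ennreal (shell_scale \<tau> t) * indicator N (shell_map \<tau> t) = 0"
    by (subst (asm) nn_integral_0_iff_AE) (auto intro!: borel_measurable_times_ennreal measurable_compose[OF shell_map_measurable])
  moreover have "AE t in unit_leb. t \<in> space unit_leb" by (rule AE_space)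
  ultimately show ?thesis
  proof eventually_elim
    case (elim t)
    have "shell_map \<tau> t \<in> space unit_leb"
      using elim(2) by (rule measurable_space[OF shell_map_measurable])
    moreover have "shell_map \<tau> t \<notin> N"
      using elim(1) shell_scale_pos[of \<tau> t] by (auto simp: indicator_def)
    ultimately show ?case using N(1) by auto
  qed
qed

text \<open>The \<open>p\<close>-th root of the Jacobian makes this composition operator isometric on $L_p$. Composition
  reverses the order of the permutations.\<close>

definition shell_op :: "real \<Rightarrow> (nat \<Rightarrow> nat) \<Rightarrow> L0 \<Rightarrow> L0" where
  "shell_op p \<tau> u = abs_L0 (\<lambda>t. shell_scale \<tau> t powr (1 / p) * rep_L0 u (shell_map \<tau> t))"

lemma shell_op_measurable:
  "(\<lambda>t. shell_scale \<tau> t powr (1 / p) * rep_L0 u (shell_map \<tau> t)) \<in> borel_measurable unit_leb"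
  by measurable

lemma rep_shell_op:
  "AE t in unit_leb. rep_L0 (shell_op p \<tau> u) t = shell_scale \<tau> t powr (1 / p) * rep_L0 u (shell_map \<tau> t)"
  unfolding shell_op_def by (rule rep_abs_L0[OF shell_op_measurable])

lemma shell_op_add:
  assumes "bij \<tau>"
  shows "shell_op p \<tau> (u + v) = shell_op p \<tau> u + shell_op p \<tau> v"
  by (rule L0_eqI)
    (use rep_shell_op[of p \<tau> u] rep_shell_op[of p \<tau> v] rep_shell_op[of p \<tau> "u + v"]
        rep_L0_add[of "shell_op p \<tau> u" "shell_op p \<tau> v"] AE_shell_map[OF assms rep_L0_add[of u v]]
      in \<open>eventually_elim, simp add: algebra_simps\<close>)

lemma shell_op_scaleR:
  assumes "bij \<tau>"
  shows "shell_op p \<tau> (c *\<^sub>R u) = c *\<^sub>R shell_op p \<tau> u"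
  by (rule L0_eqI)
    (use rep_shell_op[of p \<tau> u] rep_shell_op[of p \<tau> "c *\<^sub>R u"]
        rep_L0_scaleR[of c "shell_op p \<tau> u"] AE_shell_map[OF assms rep_L0_scaleR[of c u]]
      in \<open>eventually_elim, simp add: algebra_simps\<close>)

lemma shell_op_compose:
  assumes "bij \<tau>"
  shows "shell_op p \<tau> (shell_op p \<sigma> u) = shell_op p (\<sigma> \<circ> \<tau>) u"
proof (rule L0_eqI)
  show "AE t in unit_leb. rep_L0 (shell_op p \<tau> (shell_op p \<sigma> u)) t = rep_L0 (shell_op p (\<sigma> \<circ> \<tau>) u) t"
    using rep_shell_op[of p \<tau> "shell_op p \<sigma> u"] rep_shell_op[of p "\<sigma> \<circ> \<tau>" u]
      AE_shell_map[OF assms rep_shell_op[of p \<sigma> u]] AE_unit_pos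
  proof eventually_elim
    case (elim t)
    have s: "shell_scale \<tau> t * shell_scale \<sigma> (shell_map \<tau> t) = shell_scale (\<sigma> \<circ> \<tau>) t"
      using shell_index_map[of t \<tau>] elim(4) by (simp add: shell_scale_def)
    then have m: "shell_map \<sigma> (shell_map \<tau> t) = shell_map (\<sigma> \<circ> \<tau>) t"
      by (simp add: shell_map_def flip: mult.assoc) (simp add: mult.commute)
    show ?case
      unfolding elim(1,2,3) m s[symmetric] by (simp add: powr_mult)
  qed
qed

lemma shell_op_id: "shell_op p id u = u"
  by (rule L0_eqI)
    (use rep_shell_op[of p id u] in \<open>eventually_elim, simp add: shell_map_def shell_scale_def\<close>)

lemma Lp_eq_nn_integral:
  "u \<in> Lp p \<longleftrightarrow> (\<integral>\<^sup>+t. ennreal (\<bar>rep_L0 u t\<bar> powr p) \<partial>unit_leb) < \<infinity>"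
  "Lp_pow p u = enn2real (\<integral>\<^sup>+t. ennreal (\<bar>rep_L0 u t\<bar> powr p) \<partial>unit_leb)"
  unfolding Lp_iff Lp_pow_def by (auto simp: integrable_iff_bounded integral_eq_nn_integral)

lemma shell_op_nn_integral:
  assumes "bij \<tau>" "1 \<le> p"
  shows "(\<integral>\<^sup>+t. ennreal (\<bar>rep_L0 (shell_op p \<tau> u) t\<bar> powr p) \<partial>unit_leb)
    = (\<integral>\<^sup>+t. ennreal (\<bar>rep_L0 u t\<bar> powr p) \<partial>unit_leb)"
proof -
  have "(\<integral>\<^sup>+t. ennreal (\<bar>rep_L0 (shell_op p \<tau> u) t\<bar> powr p) \<partial>unit_leb)
    = (\<integral>\<^sup>+t. ennreal (shell_scale \<tau> t) * ennreal (\<bar>rep_L0 u (shell_map \<tau> t)\<bar> powr p) \<partial>unit_leb)"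
    by (rule nn_integral_cong_AE)
      (use rep_shell_op[of p \<tau> u] in \<open>eventually_elim, use assms(2) in
        \<open>simp add: abs_mult powr_mult powr_powr less_imp_le flip: ennreal_mult\<close>\<close>)
  also have "\<dots> = (\<integral>\<^sup>+t. ennreal (\<bar>rep_L0 u t\<bar> powr p) \<partial>unit_leb)"
    by (rule nn_integral_shell_map[OF assms(1)]) measurable
  finally show ?thesis .
qed

lemma shell_op_Isom:
  assumes \<tau>: "bij \<tau>" and p: "1 \<le> p"
  shows "restrict (shell_op p \<tau>) (Lp p) \<in> carrier (Isom_Lp p)"
proof -
  have inLp: "shell_op p \<sigma> u \<in> Lp p" if "bij \<sigma>" "u \<in> Lp p" for \<sigma> u
    using that p by (simp add: Lp_eq_nn_integral shell_op_nn_integral)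
  have \<tau>': "bij (inv_into UNIV \<tau>)" using \<tau> by (rule bij_imp_bij_inv)
  have 1: "inv_into UNIV \<tau> \<circ> \<tau> = id" "\<tau> \<circ> inv_into UNIV \<tau> = id"
    using \<tau> by (auto simp: bij_def surj_iff inj_iff)
  have "bij_betw (shell_op p \<tau>) (Lp p) (Lp p)"
    by (rule bij_betw_byWitness[where f' = "shell_op p (inv_into UNIV \<tau>)"])
      (use inLp \<tau> \<tau>' in \<open>auto simp: shell_op_compose 1 shell_op_id\<close>)
  then show ?thesis
    using \<tau> p inLp[OF \<tau>]
    by (auto simp: Isom_Lp_def Bij_def shell_op_add shell_op_scaleR Lp_add Lp_scaleR(1)
        Lp_norm_eq Lp_eq_nn_integral(2) shell_op_nn_integral)
qed

text \<open>An isometric copy of $\ell_p$: shell \<open>n\<close> has measure \<open>1 / 2 ^ Suc n\<close>, and the factor normalises its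
  indicator function. Shell operators act on this copy by permuting coordinates.\<close>

definition shell_vec :: "real \<Rightarrow> (nat \<Rightarrow> real) \<Rightarrow> L0" where
  "shell_vec p h = abs_L0 (\<lambda>t. (2 ^ Suc (shell_index t)) powr (1 / p) * h (shell_index t))"

lemma rep_shell_vec:
  "AE t in unit_leb. rep_L0 (shell_vec p h) t = (2 ^ Suc (shell_index t)) powr (1 / p) * h (shell_index t)"
  unfolding shell_vec_def
  by (rule rep_abs_L0, rule measurable_compose[OF measurable_shell_index]) simp

lemma shell_vec_add: "shell_vec p (\<lambda>n. h n + k n) = shell_vec p h + shell_vec p k"
  by (rule L0_eqI)
    (use rep_shell_vec[of p h] rep_shell_vec[of p k] rep_shell_vec[of p "\<lambda>n. h n + k n"]
        rep_L0_add[of "shell_vec p h" "shell_vec p k"]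
      in \<open>eventually_elim, simp add: algebra_simps\<close>)

lemma shell_op_vec:
  assumes \<tau>: "bij \<tau>"
  shows "shell_op p \<tau> (shell_vec p h) = shell_vec p (\<lambda>n. h (\<tau> n))"
proof (rule L0_eqI)
  show "AE t in unit_leb. rep_L0 (shell_op p \<tau> (shell_vec p h)) t = rep_L0 (shell_vec p (\<lambda>n. h (\<tau> n))) t"
    using rep_shell_op[of p \<tau> "shell_vec p h"] rep_shell_vec[of p "\<lambda>n. h (\<tau> n)"]
      AE_shell_map[OF \<tau> rep_shell_vec[of p h]] AE_unit_pos
  proof eventually_elim
    case (elim t)
    have "shell_scale \<tau> t * 2 ^ Suc (\<tau> (shell_index t)) = 2 ^ Suc (shell_index t)"
      by (simp add: shell_scale_def)
    then show ?case
      using shell_index_map[of t \<tau>] elim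
      by (simp flip: powr_mult mult.assoc del: power_Suc)
  qed
qed

lemma shell_vec_nn_integral:
  assumes p: "1 \<le> p"
  shows "(\<integral>\<^sup>+t. ennreal (\<bar>rep_L0 (shell_vec p h) t\<bar> powr p) \<partial>unit_leb) = (suminf (\<lambda>n. ennreal (\<bar>h n\<bar> powr p)))"
proof -
  let ?g = "\<lambda>t. ennreal (2 ^ Suc (shell_index t) * \<bar>h (shell_index t)\<bar> powr p)"
  have "(\<integral>\<^sup>+t. ennreal (\<bar>rep_L0 (shell_vec p h) t\<bar> powr p) \<partial>unit_leb) = (\<integral>\<^sup>+t. ?g t \<partial>unit_leb)"
    by (rule nn_integral_cong_AE)
      (use rep_shell_vec[of p h] in \<open>eventually_elim, use p in \<open>simp add: abs_mult powr_mult powr_powr\<close>\<close>)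
  also have "\<dots> = (suminf (\<lambda>n. \<integral>\<^sup>+t. ?g t * indicator (shell n) t \<partial>unit_leb))"
    by (rule nn_integral_shells, rule measurable_compose[OF measurable_shell_index]) simp
  also have "\<dots> = (suminf (\<lambda>n. ennreal (\<bar>h n\<bar> powr p)))"
  proof (rule arg_cong[where f = suminf], rule ext)
    fix n
    have "(\<integral>\<^sup>+t. ?g t * indicator (shell n) t \<partial>unit_leb)
        = (\<integral>\<^sup>+t. ennreal (2 ^ Suc n * \<bar>h n\<bar> powr p) * indicator (shell n) t \<partial>unit_leb)"
      by (rule nn_integral_cong) (auto simp: shell_index_eq split: split_indicator)
    also have "\<dots> = ennreal (2 ^ Suc n * \<bar>h n\<bar> powr p) * ennreal ((1 / 2) ^ Suc n)"
      by (simp add: nn_integral_cmult_indicator emeasure_shell del: power_Suc)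
    also have "\<dots> = ennreal (\<bar>h n\<bar> powr p)"
      by (simp add: power_one_over flip: ennreal_mult)
    finally show "(\<integral>\<^sup>+t. ?g t * indicator (shell n) t \<partial>unit_leb) = ennreal (\<bar>h n\<bar> powr p)" .
  qed
  finally show ?thesis .
qed

section \<open>Affine actions of the free group on $\ell_p$\<close>

text \<open>The cocycle with prescribed values \<open>h s\<close> on the letters, for the action
  \<open>(\<pi> (s) u) e = u (\<beta> s e)\<close> on functions; \<open>\<beta> s\<close> is therefore the inverse of the action of \<open>s\<close> on points.
  Freeness of the group means that the values on letters only have to satisfy
  \<open>h s e + h (inv_letter s) (\<beta> s e) = 0\<close>, the cocycle relation for \<open>s\<close> and its inverse.\<close>

primrec displacement :: "('l \<Rightarrow> 'e \<Rightarrow> 'e) \<Rightarrow> ('l \<Rightarrow> 'e \<Rightarrow> real) \<Rightarrow> 'l list \<Rightarrow> 'e \<Rightarrow> real" where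
  "displacement \<beta> h [] e = 0"
| "displacement \<beta> h (s # w) e = h s e + displacement \<beta> h w (\<beta> s e)"

lemma fold_push_letter:
  assumes "\<And>s e. \<beta> (inv_letter s) (\<beta> s e) = e"
  shows "fold \<beta> (push_letter s w) e = fold \<beta> w (\<beta> s e)"
  by (cases w) (auto simp: assms)

lemma fold_times:
  assumes "\<And>s e. \<beta> (inv_letter s) (\<beta> s e) = e"
  shows "fold \<beta> (foldr push_letter u v) e = fold \<beta> v (fold \<beta> u e)"
  by (induction u arbitrary: e) (auto simp: fold_push_letter[where \<beta> = \<beta>, OF assms])

lemma bij_letter:
  assumes "\<And>s e. \<beta> (inv_letter s) (\<beta> s e) = e"
  shows "bij (\<beta> s)"
proof (rule o_bij)
  show "\<beta> (inv_letter s) \<circ> \<beta> s = id" by (simp add: fun_eq_iff assms)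
  show "\<beta> s \<circ> \<beta> (inv_letter s) = id"
    using assms[of "inv_letter s"] by (simp add: fun_eq_iff)
qed

lemma bij_fold:
  assumes "\<And>s e. \<beta> (inv_letter s) (\<beta> s e) = e"
  shows "bij (fold \<beta> w)"
proof (induction w)
  case Nil
  then show ?case by (simp only: fold_Nil bij_id)
next
  case (Cons s w)
  then show ?case
    unfolding fold_Cons by (rule bij_comp[OF bij_letter[where \<beta> = \<beta>, OF assms]])
qed

lemma displacement_push_letter:
  assumes "\<And>s e. \<beta> (inv_letter s) (\<beta> s e) = e"
    and "\<And>s e. h s e + h (inv_letter s) (\<beta> s e) = 0"
  shows "displacement \<beta> h (push_letter s w) e = h s e + displacement \<beta> h w (\<beta> s e)"
proof (cases w)
  case (Cons y v)
  then show ?thesis using assms(2)[of s e] by (auto simp: assms(1) simp flip: add.assoc)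
qed simp

lemma displacement_times:
  assumes "\<And>s e. \<beta> (inv_letter s) (\<beta> s e) = e"
    and "\<And>s e. h s e + h (inv_letter s) (\<beta> s e) = 0"
  shows "displacement \<beta> h (foldr push_letter u v) e = displacement \<beta> h u e + displacement \<beta> h v (fold \<beta> u e)"
  by (induction u arbitrary: e)
    (auto simp: displacement_push_letter[where \<beta> = \<beta> and h = h, OF assms])

text \<open>A permutation action on the natural numbers with a cocycle in $\ell_p$ is carried to $L_p$ by
  \<open>shell_op\<close> and \<open>shell_vec\<close>. Since the orbit map is a cocycle of isometries, it is Lipschitz because it
  is bounded on generators, and the change of the generating set costs a constant factor.\<close>

lemma compression_ge_of_lp_action:
  fixes \<beta> :: "bool \<times> bool \<Rightarrow> nat \<Rightarrow> nat" and h :: "bool \<times> bool \<Rightarrow> nat \<Rightarrow> real"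
  assumes p: "1 \<le> p" and S: "finite_symmetric_generating F2 S"
    and inv: "\<And>s n. \<beta> (inv_letter s) (\<beta> s n) = n"
    and coc: "\<And>s n. h s n + h (inv_letter s) (\<beta> s n) = 0"
    and summ: "\<And>s. summable (\<lambda>n. \<bar>h s n\<bar> powr p)"
    and \<alpha>: "0 \<le> \<alpha>" and c: "0 < c"
    and lower: "\<And>w. reduced_word w \<Longrightarrow> w \<noteq> [] \<Longrightarrow>
      \<exists>A. finite A \<and> c * real (length w) powr (\<alpha> * p) \<le> (\<Sum>n\<in>A. \<bar>displacement \<beta> h w n\<bar> powr p)"
  shows "ereal \<alpha> \<le> equivariant_compression p F2 S"
proof -
  define \<pi> where "\<pi> w = restrict (shell_op p (fold \<beta> w)) (Lp p)" for w
  define f where "f w = shell_vec p (displacement \<beta> h w)" for w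
  have bij: "bij (fold \<beta> w)" for w by (rule bij_fold[where \<beta> = \<beta>, OF inv])
  have \<pi>_in: "\<pi> w \<in> carrier (Isom_Lp p)" for w
    unfolding \<pi>_def by (rule shell_op_Isom[OF bij p])
  have \<pi>_Lp: "shell_op p (fold \<beta> w) u \<in> Lp p" if "u \<in> Lp p" for w u
    using that p bij by (simp add: Lp_eq_nn_integral(1) shell_op_nn_integral)
  have hom: "\<pi> \<in> hom F2 (Isom_Lp p)"
  proof (rule homI)
    fix u v assume "u \<in> carrier F2" "v \<in> carrier F2"
    have "fold \<beta> (u \<otimes>\<^bsub>F2\<^esub> v) = fold \<beta> v \<circ> fold \<beta> u"
      by (simp add: F2_mult fun_eq_iff fold_times[where \<beta> = \<beta>, OF inv])
    then have "\<pi> (u \<otimes>\<^bsub>F2\<^esub> v) = compose (Lp p) (\<pi> u) (\<pi> v)"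
      by (intro ext) (simp add: \<pi>_def compose_def \<pi>_Lp shell_op_compose[OF bij])
    also have "\<dots> = \<pi> u \<otimes>\<^bsub>Isom_Lp p\<^esub> \<pi> v"
      using \<pi>_in[of u] \<pi>_in[of v] by (simp add: Isom_Lp_def BijGroup_def)
    finally show "\<pi> (u \<otimes>\<^bsub>F2\<^esub> v) = \<pi> u \<otimes>\<^bsub>Isom_Lp p\<^esub> \<pi> v" .
  qed (rule \<pi>_in)
  have f_Lp: "f w \<in> Lp p" for w
  proof (induction w)
    case Nil
    then show ?case by (simp add: f_def Lp_eq_nn_integral(1) shell_vec_nn_integral[OF p])
  next
    case (Cons s w)
    have "shell_vec p (h s) \<in> Lp p"
      by (simp add: Lp_eq_nn_integral(1) shell_vec_nn_integral[OF p] suminf_ennreal2 summ)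
    moreover have "shell_op p (fold \<beta> [s]) (f w) \<in> Lp p"
      by (rule \<pi>_Lp[OF Cons])
    moreover have "f (s # w) = shell_vec p (h s) + shell_op p (fold \<beta> [s]) (f w)"
      unfolding f_def shell_op_vec[OF bij] shell_vec_add[symmetric]
      by (rule arg_cong[where f = "shell_vec p"]) (simp add: fun_eq_iff)
    ultimately show ?case using Lp_add[OF p] by simp
  qed
  have cocycle: "is_cocycle p F2 \<pi> f"
    unfolding is_cocycle_def
  proof (intro conjI ballI)
    fix u v
    have "f (u \<otimes>\<^bsub>F2\<^esub> v) = f u + shell_op p (fold \<beta> u) (f v)"
      unfolding f_def shell_op_vec[OF bij]
        shell_vec_add[symmetric] F2_mult
      by (rule arg_cong[where f = "shell_vec p"])
        (simp add: fun_eq_iff displacement_times[where \<beta> = \<beta> and h = h, OF inv coc])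
    then show "f (u \<otimes>\<^bsub>F2\<^esub> v) = \<pi> u (f v) + f u"
      by (simp add: \<pi>_def f_Lp)
  qed (simp add: f_Lp)
  interpret Lp_cocycle F2 p \<pi> f
    by unfold_locales (use p hom cocycle in auto)
  have equi: "equivariant_Lp p F2 f"
    unfolding equivariant_Lp_def using hom cocycle Lp_zero
    by (intro bexI[of _ \<pi>] exI[of _ f] conjI bexI[of _ 0]) (auto simp: iso_zero)
  have lip: "lipschitz_Lp p F2 S f"
    unfolding lipschitz_Lp_def
  proof (intro exI ballI)
    fix x y assume xy: "x \<in> carrier F2" "y \<in> carrier F2"
    have sub: "S \<subseteq> carrier F2" and fin: "finite S"
      using S by (auto simp: finite_symmetric_generating_def)
    define g where "g = inv\<^bsub>F2\<^esub> x \<otimes>\<^bsub>F2\<^esub> y"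
    have "g \<in> carrier F2" using xy by (simp add: g_def)
    then obtain ws where ws: "set ws \<subseteq> S" "length ws = word_length F2 S g"
      "foldr (\<otimes>\<^bsub>F2\<^esub>) ws \<one>\<^bsub>F2\<^esub> = g"
      using F2.word_length_witness[OF S] by metis
    have "Lp_norm p (f (foldr (\<otimes>\<^bsub>F2\<^esub>) ws \<one>\<^bsub>F2\<^esub>)) \<le> (\<Sum>s\<in>S. Lp_norm p (f s)) * real (length ws)"
      using ws(1)
    proof (induction ws)
      case Nil
      then show ?case using p by (simp add: cocycle_one Lp_norm_eq Lp_pow_zero)
    next
      case (Cons s ws)
      let ?g = "foldr (\<otimes>\<^bsub>F2\<^esub>) ws \<one>\<^bsub>F2\<^esub>"
      have s: "s \<in> carrier F2" "s \<in> S" and g: "?g \<in> carrier F2"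
        using Cons.prems sub F2.foldr_mult_closed[of ws] by auto
      have "Lp_norm p (f (s \<otimes>\<^bsub>F2\<^esub> ?g)) \<le> Lp_norm p (\<pi> s (f ?g)) + Lp_norm p (f s)"
        unfolding cocycle_mult[OF s(1) g]
        by (rule Lp_norm_triangle[OF p iso_in[OF s(1) f_Lp] f_Lp])
      also have "Lp_norm p (\<pi> s (f ?g)) = Lp_norm p (f ?g)" by (rule iso_norm[OF s(1) f_Lp])
      also have "\<dots> \<le> (\<Sum>s\<in>S. Lp_norm p (f s)) * real (length ws)"
        using Cons by simp
      also have "Lp_norm p (f s) \<le> (\<Sum>s\<in>S. Lp_norm p (f s))"
        using s(2) fin by (intro member_le_sum) auto
      finally show ?case by (simp add: algebra_simps)
    qed
    then show "Lp_norm p (f x - f y) \<le> (\<Sum>s\<in>S. Lp_norm p (f s)) * real (word_dist F2 S x y)"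
      using ws xy by (simp add: cocycle_diff_norm word_dist_def g_def)
  qed
  obtain K where K: "0 < K" "\<And>w. w \<in> carrier F2 \<Longrightarrow> word_length F2 S w \<le> K * length w"
    using word_length_le_length[OF S] by blast
  have f_lower: "c powr (1 / p) * real (length w) powr \<alpha> \<le> Lp_norm p (f w)"
    if w: "w \<in> carrier F2" "w \<noteq> []" for w
  proof -
    obtain A where A: "finite A"
      "c * real (length w) powr (\<alpha> * p) \<le> (\<Sum>n\<in>A. \<bar>displacement \<beta> h w n\<bar> powr p)"
      using lower w by (auto simp: F2_carrier)
    let ?I = "suminf (\<lambda>n. ennreal (\<bar>displacement \<beta> h w n\<bar> powr p))"
    have I: "?I < \<infinity>" "Lp_pow p (f w) = enn2real ?I"
      using f_Lp[of w] unfolding f_def Lp_eq_nn_integral shell_vec_nn_integral[OF p] by auto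
    have "(\<Sum>n\<in>A. ennreal (\<bar>displacement \<beta> h w n\<bar> powr p)) \<le> ?I"
      using A(1) by (intro sum_le_suminf) auto
    then have "ennreal (\<Sum>n\<in>A. \<bar>displacement \<beta> h w n\<bar> powr p) \<le> ?I"
      by (simp add: sum_ennreal)
    then have "(\<Sum>n\<in>A. \<bar>displacement \<beta> h w n\<bar> powr p) \<le> Lp_pow p (f w)"
      unfolding I(2) using I(1) by (metis enn2real_ennreal enn2real_mono infinity_ennreal_def sum_nonneg powr_ge_zero)
    then have "(c * real (length w) powr (\<alpha> * p)) powr (1 / p) \<le> Lp_norm p (f w)"
      unfolding Lp_norm_eq using A(2) c p by (intro powr_mono2) auto
    then show ?thesis using p c by (simp add: powr_mult powr_powr)
  qed
  define c' where "c' = c powr (1 / p) / real K powr \<alpha>"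
  have "c' > 0" using c K by (simp add: c'_def)
  moreover have "c' * real (word_dist F2 S x y) powr \<alpha> \<le> Lp_norm p (f x - f y)"
    if xy: "x \<in> carrier F2" "y \<in> carrier F2" "x \<noteq> y" for x y
  proof -
    define g where "g = inv\<^bsub>F2\<^esub> x \<otimes>\<^bsub>F2\<^esub> y"
    have g: "g \<in> carrier F2" using xy by (simp add: g_def)
    have "g \<noteq> []"
    proof
      assume "g = []"
      then have "x \<otimes>\<^bsub>F2\<^esub> g = x" using xy by (simp flip: F2_one)
      moreover have "x \<otimes>\<^bsub>F2\<^esub> g = y" using xy by (simp add: g_def F2.m_assoc[symmetric])
      ultimately show False using xy by simp
    qed
    have "real (word_length F2 S g) \<le> real K * real (length g)"
      using K(2)[OF g] by (metis of_nat_mono of_nat_mult)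
    then have "real (word_length F2 S g) powr \<alpha> \<le> (real K * real (length g)) powr \<alpha>"
      using \<alpha> by (intro powr_mono2) auto
    then have "c' * real (word_length F2 S g) powr \<alpha> \<le> c' * (real K * real (length g)) powr \<alpha>"
      using \<open>c' > 0\<close> by (intro mult_left_mono) auto
    also have "\<dots> = c powr (1 / p) * real (length g) powr \<alpha>"
      using K by (simp add: c'_def powr_mult)
    also have "\<dots> \<le> Lp_norm p (f g)" by (rule f_lower[OF g \<open>g \<noteq> []\<close>])
    finally show ?thesis using xy by (simp add: cocycle_diff_norm word_dist_def g_def)
  qed
  ultimately show ?thesis
    unfolding equivariant_compression_def using \<alpha> equi lip by (intro SUP_upper) blast
qed

text \<open>A finite approximation to an action with growth \<open>r\<close>, valid only for words that stay in the ball of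
  radius \<open>R\<close>. The bound \<open>1\<close> on the generators is a normalisation that is uniform in \<open>R\<close>, so that models for
  different radii can be superposed.\<close>

definition ball_model :: "real \<Rightarrow> real \<Rightarrow> real \<Rightarrow> nat \<Rightarrow> 'z set \<Rightarrow>
    (bool \<times> bool \<Rightarrow> 'z \<Rightarrow> 'z) \<Rightarrow> (bool \<times> bool \<Rightarrow> 'z \<Rightarrow> real) \<Rightarrow> bool" where
  "ball_model p c r R Z \<beta> h \<longleftrightarrow> finite Z \<and>
     (\<forall>s. \<forall>z\<in>Z. \<beta> s z \<in> Z \<and> \<beta> (inv_letter s) (\<beta> s z) = z \<and> h s z + h (inv_letter s) (\<beta> s z) = 0) \<and>
     (\<forall>s. (\<Sum>z\<in>Z. \<bar>h s z\<bar> powr p) \<le> 1) \<and>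
     (\<forall>w. reduced_word w \<longrightarrow> length w \<le> R \<longrightarrow>
        c * real (length w) powr r \<le> (\<Sum>z\<in>Z. \<bar>displacement \<beta> h w z\<bar> powr p))"

lemma ex_dyadic_scale:
  assumes "1 \<le> (n :: nat)"
  obtains k where "n \<le> 2 ^ k" "2 ^ k < 2 * n"
proof -
  define k where "k = (LEAST k. n \<le> 2 ^ k)"
  have "n \<le> 2 ^ n" by (rule less_imp_le) (rule less_exp)
  then have 1: "n \<le> 2 ^ k" unfolding k_def by (rule LeastI)
  have "2 ^ k < 2 * n"
  proof (cases k)
    case (Suc j)
    then have "\<not> n \<le> 2 ^ j" unfolding k_def by (intro not_less_Least) simp
    then show ?thesis using Suc by simp
  qed (use assms in simp)
  with 1 show thesis by (rule that)
qed

text \<open>The disjoint union of the models, the \<open>k\<close>-th one scaled so that its \<open>p\<close>-th power norm is multiplied by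
  \<open>2 powr (- \<epsilon> * k)\<close>. These weights are summable, and a word of length about \<open>2 ^ k\<close> sees the growth of
  the \<open>k\<close>-th model, diminished only by a factor of order \<open>length w powr (- \<epsilon>)\<close>.\<close>

lemma compression_ge_of_dyadic_models:
  fixes Z :: "nat \<Rightarrow> 'z set"
  assumes p: "1 \<le> p" and S: "finite_symmetric_generating F2 S" and c: "0 < c"
    and model: "\<And>k. ball_model p c r (2 ^ k) (Z k) (\<beta> k) (h k)"
    and \<epsilon>: "0 < \<epsilon>" "\<epsilon> \<le> r"
  shows "ereal ((r - \<epsilon>) / p) \<le> equivariant_compression p F2 S"
proof -
  have fin: "finite (Z k)" for k using model[of k] by (simp add: ball_model_def)
  have \<beta>: "\<beta> k s z \<in> Z k" "\<beta> k (inv_letter s) (\<beta> k s z) = z" "h k s z + h k (inv_letter s) (\<beta> k s z) = 0"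
    if "z \<in> Z k" for k s z
    using model[of k, unfolded ball_model_def] that by blast+
  have h: "(\<Sum>z\<in>Z k. \<bar>h k s z\<bar> powr p) \<le> 1" for k s
    using model[of k, unfolded ball_model_def] by blast
  have growth: "c * real (length w) powr r \<le> (\<Sum>z\<in>Z k. \<bar>displacement (\<beta> k) (h k) w z\<bar> powr p)"
    if "reduced_word w" "length w \<le> 2 ^ k" for w k
    using model[of k, unfolded ball_model_def] that by blast
  define E where "E = Sigma UNIV Z"
  have "countable E" unfolding E_def using fin by (intro countable_SIGMA) (auto intro: countable_finite)
  moreover have "infinite E"
  proof
    assume "finite E"
    moreover have "Z k \<noteq> {}" for k
      using growth[of "[(True, True)]" k] c by (auto simp: reduced_Cons)
    then have "fst ` E = UNIV" by (force simp: E_def image_iff)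
    ultimately show False using infinite_UNIV_nat by (metis finite_imageI)
  qed
  ultimately have bij: "bij_betw (from_nat_into E) UNIV E"
    by (rule bij_betw_from_nat_into)
  define D where "D = from_nat_into E"
  define N where "N = the_inv_into UNIV D"
  have D_in: "D n \<in> E" for n using bij by (auto simp: D_def bij_betw_def)
  have DN: "D (N e) = e" if "e \<in> E" for e
    using bij that by (auto simp: N_def D_def bij_betw_def f_the_inv_into_f)
  have ND: "N (D n) = n" for n
    using bij by (auto simp: N_def D_def bij_betw_def the_inv_into_f_f)
  have injD: "inj D" using bij by (auto simp: D_def bij_betw_def)
  have D_Z: "snd (D n) \<in> Z (fst (D n))" for n using D_in[of n] by (auto simp: E_def)
  define wt where "wt k = 2 powr (- \<epsilon> * real k / p)" for k :: nat
  have wt_pow: "wt k powr p = (2 powr - \<epsilon>) ^ k" for k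
    using p by (simp add: wt_def powr_powr powr_realpow[symmetric])
  have wt_nonneg: "0 \<le> wt k" for k by (simp add: wt_def)
  define B where "B s n = N (fst (D n), \<beta> (fst (D n)) s (snd (D n)))" for s n
  define H where "H s n = wt (fst (D n)) * h (fst (D n)) s (snd (D n))" for s n
  have DB: "D (B s n) = (fst (D n), \<beta> (fst (D n)) s (snd (D n)))" for s n
    unfolding B_def using D_Z[of n] \<beta>(1) by (intro DN) (simp add: E_def)
  have disp: "displacement B H w n
      = wt (fst (D n)) * displacement (\<beta> (fst (D n))) (h (fst (D n))) w (snd (D n))" for w n
    by (induction w arbitrary: n) (auto simp: H_def DB algebra_simps)
  show ?thesis
  proof (rule compression_ge_of_lp_action[OF p S, of B H _ "c * 2 powr - \<epsilon>"])
    show "B (inv_letter s) (B s n) = n" for s n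
      unfolding B_def[of "inv_letter s"] DB using \<beta>(2)[OF D_Z] by (simp add: ND)
    show "H s n + H (inv_letter s) (B s n) = 0" for s n
      using \<beta>(3)[OF D_Z, of n s] unfolding H_def DB by (simp flip: distrib_left)
    show "0 \<le> (r - \<epsilon>) / p" using \<epsilon> p by simp
    show "0 < c * 2 powr - \<epsilon>" using c by simp
    show "summable (\<lambda>n. \<bar>H s n\<bar> powr p)" for s
    proof (rule summableI_nonneg_bounded)
      fix n
      have H_pow: "\<bar>H s n\<bar> powr p = (case D n of (k, z) \<Rightarrow> (2 powr - \<epsilon>) ^ k * \<bar>h k s z\<bar> powr p)" for n
        by (simp add: H_def abs_mult powr_mult wt_pow wt_nonneg case_prod_unfold)
      obtain m where m: "\<And>i. i < n \<Longrightarrow> fst (D i) < m"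
      proof -
        have "finite ((\<lambda>i. fst (D i)) ` {..<n})" by simp
        then obtain m where "(\<lambda>i. fst (D i)) ` {..<n} \<subseteq> {..<m}" using finite_nat_bounded by blast
        then show thesis using that by blast
      qed
      have "(\<Sum>i<n. \<bar>H s i\<bar> powr p) = (\<Sum>(k, z)\<in>D ` {..<n}. (2 powr - \<epsilon>) ^ k * \<bar>h k s z\<bar> powr p)"
        unfolding H_pow by (subst sum.reindex) (auto intro: inj_on_subset[OF injD])
      also have "\<dots> \<le> (\<Sum>(k, z)\<in>Sigma {..<m} Z. (2 powr - \<epsilon>) ^ k * \<bar>h k s z\<bar> powr p)"
      proof (rule sum_mono2)
        show "finite (Sigma {..<m} Z)" using fin by (intro finite_SigmaI) auto
        show "D ` {..<n} \<subseteq> Sigma {..<m} Z"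
        proof
          fix e assume "e \<in> D ` {..<n}"
          then obtain i where "i < n" "e = D i" by blast
          then show "e \<in> Sigma {..<m} Z" using m[of i] D_Z[of i] by (cases "D i") auto
        qed
      qed auto
      also have "\<dots> = (\<Sum>k<m. \<Sum>z\<in>Z k. (2 powr - \<epsilon>) ^ k * \<bar>h k s z\<bar> powr p)"
        using fin by (subst sum.Sigma) auto
      also have "\<dots> = (\<Sum>k<m. (2 powr - \<epsilon>) ^ k * (\<Sum>z\<in>Z k. \<bar>h k s z\<bar> powr p))"
        by (simp add: sum_distrib_left)
      also have "\<dots> \<le> (\<Sum>k<m. (2 powr - \<epsilon>) ^ k * 1)"
        by (intro sum_mono mult_left_mono h) auto
      also have "\<dots> \<le> 1 / (1 - 2 powr - \<epsilon>)"
      proof -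
        have lt: "norm (2 powr - \<epsilon> :: real) < 1" using \<epsilon> by (simp add: powr_less_one)
        show ?thesis
          unfolding mult_1_right suminf_geometric[OF lt, symmetric]
          by (rule sum_le_suminf[OF summable_geometric[OF lt]]) auto
      qed
      finally show "(\<Sum>i<n. \<bar>H s i\<bar> powr p) \<le> 1 / (1 - 2 powr - \<epsilon>)" .
    qed auto
    fix w :: "(bool \<times> bool) list" assume w: "reduced_word w" "w \<noteq> []"
    then have "1 \<le> length w" by (cases w) auto
    then obtain k where k: "length w \<le> 2 ^ k" "2 ^ k < 2 * length w"
      by (rule ex_dyadic_scale)
    let ?n = "real (length w)"
    have n: "0 < ?n" using w by simp
    let ?A = "(\<lambda>z. N (k, z)) ` Z k"
    have DNk: "D (N (k, z)) = (k, z)" if "z \<in> Z k" for z using that by (intro DN) (simp add: E_def)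
    have "inj_on (\<lambda>z. N (k, z)) (Z k)" by (rule inj_onI) (metis DNk prod.inject)
    then have "(\<Sum>n\<in>?A. \<bar>displacement B H w n\<bar> powr p)
        = (\<Sum>z\<in>Z k. (2 powr - \<epsilon>) ^ k * \<bar>displacement (\<beta> k) (h k) w z\<bar> powr p)"
      by (subst sum.reindex)
        (auto intro!: sum.cong simp: disp DNk abs_mult powr_mult wt_pow wt_nonneg)
    also have "\<dots> = (2 powr - \<epsilon>) ^ k * (\<Sum>z\<in>Z k. \<bar>displacement (\<beta> k) (h k) w z\<bar> powr p)"
      by (simp add: sum_distrib_left)
    also have "\<dots> \<ge> (2 powr - \<epsilon>) ^ k * (c * ?n powr r)"
      by (intro mult_left_mono growth w k) auto
    also have "(2 powr - \<epsilon>) ^ k = (2 ^ k :: real) powr - \<epsilon>"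
      by (simp add: powr_power powr_powr flip: powr_realpow) (simp add: mult.commute)
    also have "(2 ^ k :: real) powr - \<epsilon> * (c * ?n powr r) \<ge> (2 * ?n) powr - \<epsilon> * (c * ?n powr r)"
    proof (intro mult_right_mono powr_mono2')
      have "real (2 ^ k) \<le> real (2 * length w)" using k(2) by (intro of_nat_mono) simp
      then show "2 ^ k \<le> 2 * ?n" by simp
    qed (use \<epsilon> c in auto)
    also have "(2 * ?n) powr - \<epsilon> * (c * ?n powr r) = c * 2 powr - \<epsilon> * ?n powr ((r - \<epsilon>) / p * p)"
    proof -
      have "(r - \<epsilon>) / p * p = r - \<epsilon>" using p by simp
      then show ?thesis
        using n by (simp only:) (simp add: powr_mult powr_diff powr_minus field_simps)
    qed
    finally show "\<exists>A. finite A \<and> c * 2 powr - \<epsilon> * ?n powr ((r - \<epsilon>) / p * p)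
        \<le> (\<Sum>n\<in>A. \<bar>displacement B H w n\<bar> powr p)"
      using fin by (intro exI[of _ ?A]) auto
  qed
qed

lemma compression_ge_of_ball_models:
  assumes p: "1 \<le> p" and S: "finite_symmetric_generating F2 S" and c: "0 < c" and r: "0 < r"
    and model: "\<And>R. 1 \<le> R \<Longrightarrow> \<exists>(Z :: 'z set) \<beta> h. ball_model p c r R Z \<beta> h"
  shows "ereal (r / p) \<le> equivariant_compression p F2 S"
proof (rule ereal_le_epsilon2)
  fix e :: real assume e: "0 < e"
  define \<epsilon> where "\<epsilon> = min r (e * p)"
  have \<epsilon>: "0 < \<epsilon>" "\<epsilon> \<le> r" "\<epsilon> / p \<le> e" using e r p by (auto simp: \<epsilon>_def field_simps)
  have "\<forall>k. \<exists>(Z :: 'z set) \<beta> h. ball_model p c r (2 ^ k) Z \<beta> h"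
    by (intro allI model) simp
  then obtain Z :: "nat \<Rightarrow> 'z set" and \<beta> h where "\<And>k. ball_model p c r (2 ^ k) (Z k) (\<beta> k) (h k)"
    by metis
  from compression_ge_of_dyadic_models[OF p S c this \<epsilon>(1,2)]
  have "ereal ((r - \<epsilon>) / p) + ereal e \<le> equivariant_compression p F2 S + ereal e"
    by (rule add_right_mono)
  moreover have "ereal (r / p) \<le> ereal ((r - \<epsilon>) / p) + ereal e"
    using \<epsilon>(3) by (simp add: diff_divide_distrib)
  ultimately show "ereal (r / p) \<le> equivariant_compression p F2 S + ereal e"
    by (rule order_trans[rotated])
qed

section \<open>Finite quotients of the tree\<close>

definition word_ball :: "nat \<Rightarrow> (bool \<times> bool) list set" where
  "word_ball R = {w. reduced_word w \<and> length w \<le> R}"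

definition flip :: "bool \<Rightarrow> (bool \<times> bool) list \<Rightarrow> (bool \<times> bool) list" where
  "flip g = map (\<lambda>l. if fst l = g then inv_letter l else l)"

text \<open>Left translation by a letter is a partial injection of the ball. It is completed to a permutation
  as follows: a word that would leave the ball has maximal length and does not begin with the
  inverse of \<open>s\<close>; exchanging the generator of \<open>s\<close> with its inverse throughout the word produces a word of
  maximal length that does not begin with \<open>s\<close>, exactly what the completion for the inverse letter
  moves back. Words outside the ball are fixed, so that the permutation is total.\<close>

definition turn :: "nat \<Rightarrow> bool \<times> bool \<Rightarrow> (bool \<times> bool) list \<Rightarrow> (bool \<times> bool) list" where
  "turn R s v = (if v \<notin> word_ball R then v
     else if length (push_letter s v) \<le> R then push_letter s v else flip (fst s) v)"

lemma finite_word_ball: "finite (word_ball R)"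
proof (rule finite_subset)
  show "word_ball R \<subseteq> {w. set w \<subseteq> UNIV \<and> length w \<le> R}" by (auto simp: word_ball_def)
qed (rule finite_lists_length_le, simp)

lemma fst_inv_letter [simp]: "fst (inv_letter l) = fst l"
  by (simp add: inv_letter_def)

lemma inv_letter_neq [simp]: "inv_letter l \<noteq> l"
  by (cases l) (simp add: inv_letter_def)

lemma length_flip [simp]: "length (flip g w) = length w"
  by (simp add: flip_def)

lemma flip_flip [simp]: "flip g (flip g w) = w"
  by (induction w) (auto simp: flip_def)

lemma reduced_flip: "reduced_word w \<Longrightarrow> reduced_word (flip g w)"
  unfolding reduced_word_def flip_def successively_map
  by (erule successively_mono) (auto simp: inv_letter_def prod_eq_iff split: if_splits)

lemma flip_in_word_ball: "v \<in> word_ball R \<Longrightarrow> flip g v \<in> word_ball R"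
  by (simp add: word_ball_def reduced_flip)

lemma turn_in: "v \<in> word_ball R \<Longrightarrow> turn R s v \<in> word_ball R"
  by (auto simp: turn_def flip_in_word_ball) (simp add: word_ball_def reduced_push_letter)

lemma push_letter_reduced: "reduced_word (s # w) \<Longrightarrow> push_letter s w = s # w"
  by (cases w) (auto simp: reduced_Cons)

lemma turn_turn: "turn R (inv_letter s) (turn R s v) = v"
proof (cases "v \<in> word_ball R")
  case True
  then have v: "reduced_word v" "length v \<le> R" by (auto simp: word_ball_def)
  show ?thesis
  proof (cases "length (push_letter s v) \<le> R")
    case le: True
    then have "push_letter s v \<in> word_ball R"
      using v by (simp add: word_ball_def reduced_push_letter)
    moreover have "push_letter (inv_letter s) (push_letter s v) = v"
      using push_letter_cancel[OF v(1), of "inv_letter s"] by simp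
    ultimately show ?thesis using True le v by (simp add: turn_def)
  next
    case gt: False
    let ?u = "flip (fst s) v"
    have u: "?u \<in> word_ball R" using True by (rule flip_in_word_ball)
    have red: "v = [] \<or> hd v \<noteq> inv_letter s" and len: "length v = R"
      using gt v by (cases v; auto split: if_splits)+
    have "?u = [] \<or> hd ?u \<noteq> s"
      using red by (cases v) (auto simp: flip_def)
    then have "push_letter (inv_letter s) ?u = inv_letter s # ?u"
      by (cases ?u) auto
    then show ?thesis using True gt u len by (simp add: turn_def)
  qed
qed (simp add: turn_def)

lemma turn_eq_iff: "turn R (inv_letter s) v = u \<longleftrightarrow> v = turn R s u"
  using turn_turn[of R s u] turn_turn[of R "inv_letter s" v] by auto

lemma turn_reduced:
  assumes "reduced_word (s # w)" "length (s # w) \<le> R"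
  shows "turn R s w = s # w"
  using assms push_letter_reduced[OF assms(1)] by (simp add: turn_def word_ball_def reduced_Cons)

text \<open>As long as a product stays in the ball, the completed permutations still multiply words freely.\<close>

lemma foldr_turn:
  assumes "reduced_word (x @ y)" "length (x @ y) \<le> R"
  shows "foldr (turn R) x y = x @ y"
  using assms
proof (induction x)
  case (Cons s x)
  then have "reduced_word (x @ y)" by (simp add: reduced_Cons)
  with Cons have "foldr (turn R) x y = x @ y" by simp
  then show ?case using turn_reduced[of s "x @ y" R] Cons.prems by simp
qed simp

definition edges :: "nat \<Rightarrow> ((bool \<times> bool) list \<times> bool) set" where
  "edges R = word_ball R \<times> UNIV"

text \<open>The edge \<open>(v, g)\<close> joins \<open>v\<close> to \<open>v\<close> times the generator \<open>g\<close>; the group acts through the initial vertex.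
  The inverse letter appears because of the convention in \<open>displacement\<close>.\<close>

definition edge_act :: "nat \<Rightarrow> bool \<times> bool \<Rightarrow> (bool \<times> bool) list \<times> bool \<Rightarrow> (bool \<times> bool) list \<times> bool" where
  "edge_act R s e = (turn R (inv_letter s) (fst e), snd e)"

text \<open>The signed edge from the root to the vertex \<open>s\<close>. For an inverse generator the edge starts at that
  vertex and is traversed backwards.\<close>

definition edge_step :: "bool \<times> bool \<Rightarrow> (bool \<times> bool) list \<times> bool \<Rightarrow> real" where
  "edge_step s e = (if snd s then of_bool (e = ([], fst s)) else - of_bool (e = ([s], fst s)))"

lemma finite_edges: "finite (edges R)"
  by (simp add: edges_def finite_word_ball)

lemma edge_act_in: "e \<in> edges R \<Longrightarrow> edge_act R s e \<in> edges R"
  by (auto simp: edges_def edge_act_def turn_in)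

lemma edge_act_inv: "edge_act R (inv_letter s) (edge_act R s e) = e"
  using turn_turn[of R "inv_letter s" "fst e"] by (simp add: edge_act_def)

lemma edge_act_bij: "bij_betw (edge_act R s) (edges R) (edges R)"
proof (rule bij_betw_byWitness[where f' = "edge_act R (inv_letter s)"])
  show "\<forall>e\<in>edges R. edge_act R s (edge_act R (inv_letter s) e) = e"
    using edge_act_inv[of R "inv_letter s"] by simp
qed (auto simp: edge_act_inv edge_act_in)

lemma turn_Nil: "1 \<le> R \<Longrightarrow> turn R s [] = [s]"
  by (simp add: turn_def word_ball_def)

lemma turn_letter: "1 \<le> R \<Longrightarrow> turn R s [inv_letter s] = []"
  using turn_turn[of R "inv_letter s" "[]"] by (simp add: turn_Nil)

lemma edge_step_inv:
  assumes "1 \<le> R"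
  shows "edge_step s e + edge_step (inv_letter s) (edge_act R s e) = 0"
proof (cases "snd s")
  case True
  have "turn R (inv_letter s) (fst e) = [inv_letter s] \<longleftrightarrow> fst e = []"
    by (simp add: turn_eq_iff turn_letter[OF assms])
  then show ?thesis using True
    by (simp add: edge_step_def edge_act_def prod_eq_iff) (simp add: inv_letter_def)
next
  case False
  have "turn R (inv_letter s) (fst e) = [] \<longleftrightarrow> fst e = [s]"
    by (simp add: turn_eq_iff turn_Nil[OF assms])
  then show ?thesis using False
    by (simp add: edge_step_def edge_act_def prod_eq_iff) (simp add: inv_letter_def)
qed

text \<open>The signed indicator of the edge path from the root to a vertex.\<close>

abbreviation flow :: "nat \<Rightarrow> (bool \<times> bool) list \<Rightarrow> (bool \<times> bool) list \<times> bool \<Rightarrow> real" where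
  "flow R \<equiv> displacement (edge_act R) edge_step"

lemma displacement_snoc:
  "displacement \<beta> h (w @ [s]) e = displacement \<beta> h w e + h s (fold \<beta> w e)"
  by (induction w arbitrary: e) auto

lemma fold_edge_act:
  "fold (edge_act R) w e = (u, g) \<longleftrightarrow> e = (foldr (turn R) w u, g)"
proof (induction w arbitrary: e)
  case (Cons s w)
  then show ?case
    by (cases e) (auto simp: edge_act_def turn_eq_iff)
qed auto

lemma flow_snoc:
  assumes w: "reduced_word (w @ [s])" "length (w @ [s]) \<le> R"
  shows "flow R (w @ [s]) e = flow R w e + (if snd s then of_bool (e = (w, fst s)) else - of_bool (e = (w @ [s], fst s)))"
proof -
  have "foldr (turn R) w [] = w"
    using foldr_turn[of w "[]" R] w by (simp add: reduced_snoc)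
  moreover have "foldr (turn R) w [s] = w @ [s]"
    using w by (rule foldr_turn)
  ultimately show ?thesis
    by (simp add: displacement_snoc edge_step_def fold_edge_act)
qed

text \<open>Appending a letter adds one signed edge to the path. That it is a new edge follows from the first
  condition, which says how far the path has gone: an edge whose initial vertex has the full length
  of \<open>w\<close> can only be the last one, traversed backwards, and a reduced word does not return along it.\<close>

lemma flow_properties:
  assumes "reduced_word w" "length w \<le> R"
  shows "(\<forall>v g. flow R w (v, g) \<noteq> 0 \<longrightarrow>
        length v \<le> length w \<and> (length v = length w \<longrightarrow> w \<noteq> [] \<and> last w = (g, False)))
    \<and> (\<forall>e. flow R w e \<in> {-1, 0, 1})
    \<and> (\<Sum>e\<in>edges R. (flow R w e)\<^sup>2) = real (length w)"
  using assms
proof (induction w rule: rev_induct)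
  case Nil
  then show ?case by simp
next
  case (snoc s w)
  have red: "reduced_word w" "w = [] \<or> last w \<noteq> inv_letter s"
    using snoc.prems(1) by (auto simp: reduced_snoc)
  have IH: "\<And>v g. flow R w (v, g) \<noteq> 0 \<Longrightarrow>
        length v \<le> length w \<and> (length v = length w \<longrightarrow> w \<noteq> [] \<and> last w = (g, False))"
    "\<And>e. flow R w e \<in> {-1, 0, 1}"
    "(\<Sum>e\<in>edges R. (flow R w e)\<^sup>2) = real (length w)"
    using snoc.IH[OF red(1)] snoc.prems(2) by auto
  define e0 where "e0 = (if snd s then (w, fst s) else (w @ [s], fst s))"
  define \<sigma> :: real where "\<sigma> = (if snd s then 1 else -1)"
  have step: "flow R (w @ [s]) e = flow R w e + (if e = e0 then \<sigma> else 0)" for e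
    unfolding flow_snoc[OF snoc.prems] by (simp add: e0_def \<sigma>_def)
  have new: "flow R w e0 = 0"
  proof (rule ccontr)
    assume ne: "flow R w e0 \<noteq> 0"
    show False
    proof (cases "snd s")
      case True
      then have "w \<noteq> [] \<and> last w = (fst s, False)"
        using ne IH(1)[of w "fst s"] by (simp add: e0_def)
      moreover have "inv_letter s = (fst s, False)" using True by (simp add: inv_letter_def)
      ultimately show False using red by auto
    next
      case False
      then show False using ne IH(1)[of "w @ [s]" "fst s"] by (simp add: e0_def)
    qed
  qed
  have e0: "e0 \<in> edges R"
    using snoc.prems red by (auto simp: e0_def edges_def word_ball_def)
  have "(flow R (w @ [s]) e)\<^sup>2 = (flow R w e)\<^sup>2 + (if e = e0 then 1 else 0)" for e
    unfolding step using new by (auto simp: \<sigma>_def)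
  then have "(\<Sum>e\<in>edges R. (flow R (w @ [s]) e)\<^sup>2) = real (length (w @ [s]))"
    using IH(3) e0 by (simp add: sum.distrib sum.delta finite_edges)
  moreover have "flow R (w @ [s]) e \<in> {-1, 0, 1}" for e
    unfolding step using new IH(2)[of e] by (auto simp: \<sigma>_def)
  moreover have "length v \<le> length (w @ [s]) \<and> (length v = length (w @ [s]) \<longrightarrow>
      w @ [s] \<noteq> [] \<and> last (w @ [s]) = (g, False))" if "flow R (w @ [s]) (v, g) \<noteq> 0" for v g
  proof (cases "(v, g) = e0")
    case True
    then show ?thesis by (cases s) (auto simp: e0_def split: if_splits)
  next
    case False
    then have "flow R w (v, g) \<noteq> 0" using that unfolding step by simp
    from IH(1)[OF this] show ?thesis by auto
  qed
  ultimately show ?case by blast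
qed

lemma edge_step_eq:
  "edge_step s e = (if e = (if snd s then [] else [s], fst s) then (if snd s then 1 else -1) else 0)"
  by (simp add: edge_step_def)

lemma edge_step_support: "1 \<le> R \<Longrightarrow> (if snd s then [] else [s], fst s) \<in> edges R"
  by (auto simp: edges_def word_ball_def reduced_Cons)

lemma ball_model_edges:
  assumes p: "0 < p" and R: "1 \<le> R"
  shows "ball_model p 1 1 R (edges R) (edge_act R) edge_step"
  unfolding ball_model_def
proof (intro conjI allI ballI impI)
  fix s
  have "\<bar>edge_step s e\<bar> powr p = (if e = (if snd s then [] else [s], fst s) then 1 else 0)" for e
    using p by (simp add: edge_step_eq)
  then show "(\<Sum>e\<in>edges R. \<bar>edge_step s e\<bar> powr p) \<le> 1"
    by (simp add: sum.delta finite_edges)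
next
  fix w :: "(bool \<times> bool) list" assume w: "reduced_word w" "length w \<le> R"
  have "\<bar>flow R w e\<bar> powr p = (flow R w e)\<^sup>2" for e
    using flow_properties[OF w] p by (metis (no_types, lifting) abs_0 abs_1 abs_minus_cancel insertE
      power2_minus power_one powr_one_eq_one powr_0 power_zero_numeral singletonD)
  then have "(\<Sum>e\<in>edges R. \<bar>flow R w e\<bar> powr p) = (\<Sum>e\<in>edges R. (flow R w e)\<^sup>2)" by simp
  also have "\<dots> = real (length w)" using flow_properties[OF w] by blast
  finally show "1 * real (length w) powr 1 \<le> (\<Sum>e\<in>edges R. \<bar>flow R w e\<bar> powr p)" by simp
qed (use R in \<open>auto simp: finite_edges edge_act_in edge_act_inv edge_step_inv\<close>)

section \<open>Random signs\<close>

definition sign_in :: "'e set \<Rightarrow> 'e \<Rightarrow> real" where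
  "sign_in Y e = (if e \<in> Y then 1 else -1)"

text \<open>Orthogonality of independent signs, by conditioning on one of them:
  the mean of \<open>(t + a)\<^sup>2\<close> and \<open>(t - a)\<^sup>2\<close> is \<open>t\<^sup>2 + a\<^sup>2\<close>.\<close>

lemma sign_second_moment:
  assumes "finite A"
  shows "(\<Sum>Y\<in>Pow A. (\<Sum>e\<in>A. a e * sign_in Y e)\<^sup>2) = 2 ^ card A * (\<Sum>e\<in>A. (a e)\<^sup>2)"
  using assms
proof (induction A rule: finite_induct)
  case empty
  then show ?case by simp
next
  case (insert x A)
  define T where "T Y = (\<Sum>e\<in>A. a e * sign_in Y e)" for Y
  have T: "T (insert x Y) = T Y" for Y
    unfolding T_def using insert.hyps by (intro sum.cong) (auto simp: sign_in_def)
  have disj: "Pow A \<inter> insert x ` Pow A = {}" using insert.hyps by blast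
  have inj: "inj_on (insert x) (Pow A)"
    using insert.hyps by (auto simp: inj_on_def)
  have "(\<Sum>Y\<in>Pow (insert x A). (\<Sum>e\<in>insert x A. a e * sign_in Y e)\<^sup>2)
      = (\<Sum>Y\<in>Pow (insert x A). (a x * sign_in Y x + T Y)\<^sup>2)"
    using insert.hyps by (simp add: T_def)
  also have "\<dots> = (\<Sum>Y\<in>Pow A. (a x * sign_in Y x + T Y)\<^sup>2)
      + (\<Sum>Y\<in>Pow A. (a x * sign_in (insert x Y) x + T Y)\<^sup>2)"
    unfolding Pow_insert using insert.hyps disj inj
    by (subst sum.union_disjoint) (simp_all add: sum.reindex T)
  also have "(\<Sum>Y\<in>Pow A. (a x * sign_in Y x + T Y)\<^sup>2) = (\<Sum>Y\<in>Pow A. (T Y - a x)\<^sup>2)"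
    using insert.hyps by (intro sum.cong) (auto simp: sign_in_def)
  also have "\<dots> + (\<Sum>Y\<in>Pow A. (a x * sign_in (insert x Y) x + T Y)\<^sup>2)
      = (\<Sum>Y\<in>Pow A. 2 * (T Y)\<^sup>2 + 2 * (a x)\<^sup>2)"
    unfolding sum.distrib[symmetric]
    by (intro sum.cong) (auto simp: sign_in_def power2_eq_square algebra_simps)
  also have "\<dots> = 2 * (\<Sum>Y\<in>Pow A. (T Y)\<^sup>2) + 2 ^ card A * (2 * (a x)\<^sup>2)"
    using insert.hyps by (simp add: sum.distrib sum_distrib_left card_Pow)
  also have "(\<Sum>Y\<in>Pow A. (T Y)\<^sup>2) = 2 ^ card A * (\<Sum>e\<in>A. (a e)\<^sup>2)"
    unfolding T_def by (rule insert.IH)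
  finally show ?case using insert.hyps by (simp add: algebra_simps)
qed

text \<open>Each edge becomes a coordinate function on the cube of sign patterns, and the path becomes a sum of
  independent signs. The action permutes the edges, hence the patterns. For \<open>p \<ge> 2\<close> the \<open>p\<close>-th moment is
  controlled from below by the second moment; the constant comes from \<open>powr_ge_linear\<close> at half of that
  moment.\<close>

lemma ball_model_signs:
  assumes p: "2 \<le> p" and R: "1 \<le> R"
  shows "\<exists>h. ball_model p (2 powr - (p / 2)) (p / 2) R (Pow (edges R)) (\<lambda>s Y. edge_act R s ` Y) h"
proof -
  let ?E = "edges R"
  define N where "N = (2 :: real) ^ card ?E"
  have N: "0 < N" by (simp add: N_def)
  \<comment> \<open>Passes from counting to normalised counting measure on the cube.\<close>
  define k where "k = N powr (- 1 / p)"
  have "k powr p = N powr (- 1 / p * p)" unfolding k_def by (rule powr_powr)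
  also have "- 1 / p * p = - 1" using p by simp
  finally have k: "k powr p = 1 / N" using N by (simp add: powr_minus_divide)
  have k0: "0 \<le> k" by (simp add: k_def)
  have cardZ: "real (card (Pow ?E)) = N" by (simp add: card_Pow finite_edges N_def)
  define h where "h s Y = k * (\<Sum>e\<in>?E. edge_step s e * sign_in Y e)" for s Y
  have inj: "inj (edge_act R s)" for s
    by (rule inj_on_inverseI[where g = "edge_act R (inv_letter s)"]) (rule edge_act_inv)
  have move: "(\<Sum>e\<in>?E. a e * sign_in (edge_act R s ` Y) e) = (\<Sum>e\<in>?E. a (edge_act R s e) * sign_in Y e)"
    for a s Y
  proof -
    have "(\<Sum>e\<in>?E. a e * sign_in (edge_act R s ` Y) e)
        = (\<Sum>e\<in>?E. a (edge_act R s e) * sign_in (edge_act R s ` Y) (edge_act R s e))"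
      by (rule sum.reindex_bij_betw[OF edge_act_bij, symmetric])
    then show ?thesis by (simp add: sign_in_def inj_image_mem_iff[OF inj])
  qed
  have disp: "displacement (\<lambda>s Y. edge_act R s ` Y) h w Y = k * (\<Sum>e\<in>?E. flow R w e * sign_in Y e)" for w Y
    by (induction w arbitrary: Y) (auto simp: h_def move sum.distrib distrib_right distrib_left)
  have "ball_model p (2 powr - (p / 2)) (p / 2) R (Pow ?E) (\<lambda>s Y. edge_act R s ` Y) h"
    unfolding ball_model_def
  proof (intro conjI allI ballI impI)
    fix s Y assume "Y \<in> Pow ?E"
    then show "edge_act R s ` Y \<in> Pow ?E" using edge_act_in by blast
    show "edge_act R (inv_letter s) ` edge_act R s ` Y = Y"
      by (simp add: image_image edge_act_inv)
    have "h s Y + h (inv_letter s) (edge_act R s ` Y)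
        = k * (\<Sum>e\<in>?E. (edge_step s e + edge_step (inv_letter s) (edge_act R s e)) * sign_in Y e)"
      by (simp add: h_def move sum.distrib distrib_right distrib_left)
    then show "h s Y + h (inv_letter s) (edge_act R s ` Y) = 0"
      by (simp add: edge_step_inv[OF R])
  next
    fix s
    have "\<bar>h s Y\<bar> powr p = 1 / N" for Y
    proof -
      define e0 where "e0 = (if snd s then [] else [s], fst s)"
      have "(\<Sum>e\<in>?E. edge_step s e * sign_in Y e) = (\<Sum>e\<in>?E. if e = e0 then (if snd s then 1 else -1) * sign_in Y e else 0)"
        by (intro sum.cong) (auto simp: edge_step_eq e0_def)
      also have "\<dots> = (if snd s then 1 else -1) * sign_in Y e0"
        using edge_step_support[OF R, of s] by (simp add: sum.delta finite_edges e0_def)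
      finally have "\<bar>h s Y\<bar> = k" using k0 by (simp add: h_def sign_in_def abs_mult)
      then show ?thesis by (simp add: k)
    qed
    then show "(\<Sum>Y\<in>Pow ?E. \<bar>h s Y\<bar> powr p) \<le> 1"
      using cardZ N by simp
  next
    fix w :: "(bool \<times> bool) list" assume w: "reduced_word w" "length w \<le> R"
    let ?d = "real (length w)" and ?F = "\<lambda>Y. (\<Sum>e\<in>?E. flow R w e * sign_in Y e)"
    show "2 powr - (p / 2) * ?d powr (p / 2)
        \<le> (\<Sum>Y\<in>Pow ?E. \<bar>displacement (\<lambda>s Y. edge_act R s ` Y) h w Y\<bar> powr p)"
    proof (cases "w = []")
      case True
      then show ?thesis using p by (simp add: sum_nonneg)
    next
      case False
      then have d: "0 < ?d / 2" by simp
      have "2 powr - (p / 2) * ?d powr (p / 2) = (?d / 2) powr (p / 2)"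
        by (simp add: powr_divide powr_minus_divide)
      also have "\<dots> = 1 / N * ((?d / 2) powr (p / 2 - 1) * (N * ?d - N * (?d / 2)))"
      proof -
        have "(?d / 2) powr (p / 2) = (?d / 2) powr (p / 2 - 1) * (?d / 2)"
          using powr_add[of "?d / 2" "p / 2 - 1" 1] d by simp
        moreover have "N * ?d - N * (?d / 2) = N * (?d / 2)" by simp
        ultimately show ?thesis using N by simp
      qed
      also have "N * ?d = (\<Sum>Y\<in>Pow ?E. (?F Y)\<^sup>2)"
        using flow_properties[OF w] by (simp add: sign_second_moment finite_edges N_def)
      also have "\<dots> - N * (?d / 2) = (\<Sum>Y\<in>Pow ?E. (?F Y)\<^sup>2 - ?d / 2)"
        by (simp add: sum_subtractf cardZ)
      also have "1 / N * ((?d / 2) powr (p / 2 - 1) * (\<Sum>Y\<in>Pow ?E. (?F Y)\<^sup>2 - ?d / 2))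
          = (\<Sum>Y\<in>Pow ?E. 1 / N * ((?d / 2) powr (p / 2 - 1) * ((?F Y)\<^sup>2 - ?d / 2)))"
        by (simp only: sum_distrib_left)
      also have "\<dots> \<le> (\<Sum>Y\<in>Pow ?E. 1 / N * ((?F Y)\<^sup>2) powr (p / 2))"
        using p d N by (intro sum_mono mult_left_mono powr_ge_linear) auto
      also have "\<dots> = (\<Sum>Y\<in>Pow ?E. \<bar>displacement (\<lambda>s Y. edge_act R s ` Y) h w Y\<bar> powr p)"
      proof (rule sum.cong)
        fix Y
        have "((?F Y)\<^sup>2) powr (p / 2) = (\<bar>?F Y\<bar> powr 2) powr (p / 2)" by simp
        also have "\<dots> = \<bar>?F Y\<bar> powr p" by (simp only: powr_powr) simp
        finally show "1 / N * ((?F Y)\<^sup>2) powr (p / 2)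
            = \<bar>displacement (\<lambda>s Y. edge_act R s ` Y) h w Y\<bar> powr p"
          using k0 by (simp add: disp abs_mult powr_mult k)
      qed simp
      finally show ?thesis .
    qed
  qed (simp add: finite_edges)
  then show ?thesis by blast
qed

section \<open>The compression exponent of the free group\<close>

theorem mainTheorem6:
  fixes p :: real and S :: "(bool \<times> bool) list set"
  assumes "1 \<le> p" and "finite_symmetric_generating F2 S"
  shows "equivariant_compression p F2 S = ereal (max (1 / 2) (1 / p))"
proof (rule antisym)
  show "equivariant_compression p F2 S \<le> ereal (max (1 / 2) (1 / p))"
    unfolding equivariant_compression_def
  proof (rule SUP_least)
    fix \<alpha> assume "\<alpha> \<in> {\<alpha>. 0 \<le> \<alpha> \<and>
        (\<exists>f. equivariant_Lp p F2 f \<and> lipschitz_Lp p F2 S f \<and>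
          (\<exists>c>0. \<forall>x\<in>carrier F2. \<forall>y\<in>carrier F2. x \<noteq> y \<longrightarrow>
             Lp_norm p (f x - f y) \<ge> c * real (word_dist F2 S x y) powr \<alpha>))}"
    then obtain f c where "0 \<le> \<alpha>" "equivariant_Lp p F2 f" "c > 0"
      "\<And>x y. x \<in> carrier F2 \<Longrightarrow> y \<in> carrier F2 \<Longrightarrow> x \<noteq> y \<Longrightarrow>
        c * real (word_dist F2 S x y) powr \<alpha> \<le> Lp_norm p (f x - f y)"
      by blast
    then have "\<alpha> \<le> max (1 / 2) (1 / p)"
      by (intro compression_exponent_le[OF assms])
    then show "ereal \<alpha> \<le> ereal (max (1 / 2) (1 / p))" by (simp only: ereal_less_eq)
  qed
  show "ereal (max (1 / 2) (1 / p)) \<le> equivariant_compression p F2 S"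
  proof (cases "p \<le> 2")
    case True
    have "ereal (1 / p) \<le> equivariant_compression p F2 S"
    proof (rule compression_ge_of_ball_models[OF assms, of 1 1])
      fix R :: nat assume "1 \<le> R"
      then show "\<exists>(Z :: ((bool \<times> bool) list \<times> bool) set) \<beta> h. ball_model p 1 1 R Z \<beta> h"
        using ball_model_edges[of p R] assms(1) by auto
    qed auto
    moreover have "max (1 / 2) (1 / p) = 1 / p" using True assms(1) by (simp add: field_simps)
    ultimately show ?thesis by simp
  next
    case False
    have "ereal (p / 2 / p) \<le> equivariant_compression p F2 S"
    proof (rule compression_ge_of_ball_models[OF assms, of "2 powr - (p / 2)" "p / 2"])
      fix R :: nat assume "1 \<le> R"
      then show "\<exists>(Z :: ((bool \<times> bool) list \<times> bool) set set) \<beta> h. ball_model p (2 powr - (p / 2)) (p / 2) R Z \<beta> h"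
        using ball_model_signs[of p R] False by fastforce
    qed (use assms(1) in auto)
    moreover have "max (1 / 2) (1 / p) = p / 2 / p" using False by (simp add: field_simps)
    ultimately show ?thesis by simp
  qed
qed

end
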